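(* Let $\mathscr{S}$ be an arbitrary semiring. For all integers $r,r',r'',r'''\ge 2$: the scalar reachability problem for $r$ matrices over $\mathscr{S}$ is equivalent to the scalar reachability problem for $r'$ matrices over $\mathscr{S}$, which reduces to the vector reachability problem for $r''$ matrices over $\mathscr{S}$, which is equivalent to the matrix reachability problem for $r'''$ matrices over $\mathscr{S}$.
   Context: A semiring $\mathscr{S}$ is a set with an addition and a multiplication such that $\mathscr{S}$ is a commutative monoid for addition, a monoid for multiplication, multiplication distributes on the left and on the right over addition, and the zero element is left and right absorbing for multiplication. Problems over $\mathscr{S}$ for $r$ matrices (the dimension $n$ is arbitrary and part of the instance): - Matrix reachability: given $n\times n$ matrices $A_1,\dots,A_r$ and $M$ with entries in $\mathscr{S}$, is there a finite sequence $1\le i_1,\dots,i_k\le r$ with $k\ge 1$ such that $A_{i_1}\cdots A_{i_k}=M$? - Vector reachability: given $n\times n$ matrices $A_1,\dots,A_r$ and $1\times n$ matrices $\alpha,\eta$ with entries in $\mathscr{S}$, is there a finite sequence $1\le i_1,\dots,i_k\le r$ with $k\ge1$ such that $\alpha A_{i_1}\cdots A_{i_k}=\eta$? - Scalar reachability: given $n\times n$ matrices $A_1,\dots,A_r$, a $1\times n$ matrix $\alpha$, an $n\times 1$ matrix $\beta$, all with entries in $\mathscr{S}$, and $\gamma\in\mathscr{S}$, is there a finite sequence $1\le i_1,\dots,i_k\le r$ with $k\ge1$ such that $\alpha A_{i_1}\cdots A_{i_k}\beta=\gamma$? Reduction: the elements of $\mathscr{S}$ are assumed to be represented in some effective way,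 and oracles are available which take representations of $a,b\in\mathscr{S}$ and return representations of $a+b$ and $ab$, and the truth value of $a=b$. A problem $P'$ reduces to a problem $P$ if there is an algorithm solving $P'$ using an oracle solving $P$ together with the oracles computing the sum and the product and checking equality in $\mathscr{S}$ (a form of Turing reduction). $P$ and $P'$ are equivalent if each reduces to the other. *)

theory Defs
  imports "Jordan_Normal_Form.Matrix"
begin

section \<open>Algorithms with oracles\<close>

text \<open>
  All finite data (representations of scalars, inputs, outputs) are binary trees. Algorithms are
  written in a variant of Jones' Turing-complete language WHILE: tree operations, composition,
  conditionals, unbounded iteration, and oracle calls. As usual there, the leaf has leaves as
  subtrees, and counts as false in tests.
\<close>

datatype tree = Leaf | Node tree tree

primrec left :: "tree \<Rightarrow> tree" where
  "left Leaf = Leaf"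
| "left (Node s t) = s"

primrec right :: "tree \<Rightarrow> tree" where
  "right Leaf = Leaf"
| "right (Node s t) = t"

datatype 'o prog =
    Const tree
  | Id
  | Left
  | Right
  | Pair "'o prog" "'o prog"
  | Seq "'o prog" "'o prog"
  | Cond "'o prog" "'o prog" "'o prog"
  | While "'o prog" "'o prog"
  | Call 'o

text \<open>
  \<open>eval \<Gamma> p x y\<close>: program \<open>p\<close> halts on input \<open>x\<close> with output \<open>y\<close>, calls to oracle \<open>i\<close> being
  answered by the partial function \<open>\<Gamma> i\<close>. A call outside the domain of the oracle never returns.
\<close>

inductive eval :: "('o \<Rightarrow> tree \<Rightarrow> tree option) \<Rightarrow> 'o prog \<Rightarrow> tree \<Rightarrow> tree \<Rightarrow> bool"
  for \<Gamma> :: "'o \<Rightarrow> tree \<Rightarrow> tree option" where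
  eval_Const: "eval \<Gamma> (Const c) x c"
| eval_Id: "eval \<Gamma> Id x x"
| eval_Left: "eval \<Gamma> Left x (left x)"
| eval_Right: "eval \<Gamma> Right x (right x)"
| eval_Pair: "eval \<Gamma> p x y \<Longrightarrow> eval \<Gamma> q x z \<Longrightarrow> eval \<Gamma> (Pair p q) x (Node y z)"
| eval_Seq: "eval \<Gamma> p x y \<Longrightarrow> eval \<Gamma> q y z \<Longrightarrow> eval \<Gamma> (Seq p q) x z"
| eval_Cond_true:
    "eval \<Gamma> c x b \<Longrightarrow> b \<noteq> Leaf \<Longrightarrow> eval \<Gamma> p x y \<Longrightarrow> eval \<Gamma> (Cond c p q) x y"
| eval_Cond_false:
    "eval \<Gamma> c x Leaf \<Longrightarrow> eval \<Gamma> q x y \<Longrightarrow> eval \<Gamma> (Cond c p q) x y"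
| eval_While_done:
    "eval \<Gamma> c x Leaf \<Longrightarrow> eval \<Gamma> (While c p) x x"
| eval_While_step:
    "eval \<Gamma> c x b \<Longrightarrow> b \<noteq> Leaf \<Longrightarrow> eval \<Gamma> p x y \<Longrightarrow> eval \<Gamma> (While c p) y z \<Longrightarrow>
     eval \<Gamma> (While c p) x z"
| eval_Call: "\<Gamma> i x = Some y \<Longrightarrow> eval \<Gamma> (Call i) x y"

inductive_cases eval_ConstE: "eval \<Gamma> (Const c) x y"
inductive_cases eval_IdE: "eval \<Gamma> Id x y"
inductive_cases eval_LeftE: "eval \<Gamma> Left x y"
inductive_cases eval_RightE: "eval \<Gamma> Right x y"
inductive_cases eval_PairE: "eval \<Gamma> (Pair p q) x y"
inductive_cases eval_SeqE: "eval \<Gamma> (Seq p q) x y"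
inductive_cases eval_CondE: "eval \<Gamma> (Cond c p q) x y"
inductive_cases eval_WhileE: "eval \<Gamma> (While c p) x y"
inductive_cases eval_CallE: "eval \<Gamma> (Call i) x y"

lemma eval_deterministic: "eval \<Gamma> p x y \<Longrightarrow> eval \<Gamma> p x y' \<Longrightarrow> y = y'"
proof (induction arbitrary: y' rule: eval.induct)
  case (eval_Pair p x y q z)
  then show ?case by (blast elim: eval_PairE)
next
  case (eval_Seq p x y q z)
  then show ?case by (blast elim: eval_SeqE)
next
  case (eval_Cond_true c x b p y q)
  from eval_Cond_true.prems show ?case
    by (rule eval_CondE) (use eval_Cond_true in blast)+
next
  case (eval_Cond_false c x q y p)
  from eval_Cond_false.prems show ?case
    by (rule eval_CondE) (use eval_Cond_false in blast)+
next
  case (eval_While_done c x p)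
  from eval_While_done.prems show ?case
    by (rule eval_WhileE) (use eval_While_done in blast)+
next
  case (eval_While_step c x b p y z)
  from eval_While_step.prems show ?case
    by (rule eval_WhileE) (use eval_While_step in blast)+
qed (auto elim: eval_ConstE eval_IdE eval_LeftE eval_RightE eval_CallE)

definition bool_code :: "bool \<Rightarrow> tree" where
  "bool_code b = (if b then Node Leaf Leaf else Leaf)"

fun list_code :: "tree list \<Rightarrow> tree" where
  "list_code [] = Leaf"
| "list_code (t # ts) = Node t (list_code ts)"

lemma list_code_inject [simp]: "list_code ss = list_code ts \<longleftrightarrow> ss = ts"
proof (induction ss arbitrary: ts)
  case Nil
  show ?case by (cases ts) auto
next
  case (Cons s ss)
  then show ?case by (cases ts) auto
qed


section \<open>Reductions over a represented semiring\<close>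

text \<open>
  The sort \<open>{semiring_0, monoid_mult}\<close> is that of arbitrary semirings with \<open>0\<close> and \<open>1\<close>: unlike
  \<open>semiring_1\<close> it does not impose \<open>0 \<noteq> 1\<close>.

  \<open>\<rho> t = Some a\<close> means that \<open>t\<close> represents \<open>a\<close>. An element may have several representations, and
  the set of representations need not be decidable.
\<close>

definition representation :: "(tree \<Rightarrow> 's option) \<Rightarrow> bool" where
  "representation \<rho> \<longleftrightarrow> (\<forall>a. \<exists>t. \<rho> t = Some a)"

text \<open>
  A problem is given by the codes of its instances, each paired with the right answer; nothing is
  required on trees that are not codes of instances.
\<close>

type_synonym problem = "(tree \<times> bool) set"

datatype oracle_id = Sum_Oracle | Product_Oracle | Equality_Oracle | Problem_Oracle

definition arithmetic_oracles ::
  "(tree \<Rightarrow> 's::{semiring_0,monoid_mult} option) \<Rightarrow> (oracle_id \<Rightarrow> tree \<Rightarrow> tree option) \<Rightarrow> bool" where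
  "arithmetic_oracles \<rho> \<Gamma> \<longleftrightarrow>
     (\<forall>s t a b. \<rho> s = Some a \<and> \<rho> t = Some b \<longrightarrow>
        (\<exists>u. \<Gamma> Sum_Oracle (Node s t) = Some u \<and> \<rho> u = Some (a + b)) \<and>
        (\<exists>u. \<Gamma> Product_Oracle (Node s t) = Some u \<and> \<rho> u = Some (a * b)) \<and>
        \<Gamma> Equality_Oracle (Node s t) = Some (bool_code (a = b)))"

definition problem_oracle :: "problem \<Rightarrow> (oracle_id \<Rightarrow> tree \<Rightarrow> tree option) \<Rightarrow> bool" where
  "problem_oracle P \<Gamma> \<longleftrightarrow> (\<forall>(t, b) \<in> P. \<Gamma> Problem_Oracle t = Some (bool_code b))"

definition solves :: "(oracle_id \<Rightarrow> tree \<Rightarrow> tree option) \<Rightarrow> oracle_id prog \<Rightarrow> problem \<Rightarrow> bool" where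
  "solves \<Gamma> p P \<longleftrightarrow> (\<forall>(t, b) \<in> P. eval \<Gamma> p t (bool_code b))"

text \<open>\<open>reduces \<rho> P' P\<close>: the problem \<open>P'\<close> reduces to \<open>P\<close>.\<close>

definition reduces ::
  "(tree \<Rightarrow> 's::{semiring_0,monoid_mult} option) \<Rightarrow> problem \<Rightarrow> problem \<Rightarrow> bool" where
  "reduces \<rho> P' P \<longleftrightarrow>
     (\<exists>p. \<forall>\<Gamma>. arithmetic_oracles \<rho> \<Gamma> \<and> problem_oracle P \<Gamma> \<longrightarrow> solves \<Gamma> p P')"

definition equivalent ::
  "(tree \<Rightarrow> 's::{semiring_0,monoid_mult} option) \<Rightarrow> problem \<Rightarrow> problem \<Rightarrow> bool" where
  "equivalent \<rho> P P' \<longleftrightarrow> reduces \<rho> P P' \<and> reduces \<rho> P' P"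


section \<open>Reachability problems\<close>

definition word_product :: "nat \<Rightarrow> 's::{semiring_0,monoid_mult} mat list \<Rightarrow> nat list \<Rightarrow> 's mat" where
  "word_product n As w = foldr (\<lambda>i B. As ! i * B) w (1\<^sub>m n)"

definition words :: "nat \<Rightarrow> nat list set" where
  "words r = {w. w \<noteq> [] \<and> set w \<subseteq> {..<r}}"

definition matrix_reachable ::
  "nat \<Rightarrow> 's::{semiring_0,monoid_mult} mat list \<Rightarrow> 's mat \<Rightarrow> bool" where
  "matrix_reachable n As M \<longleftrightarrow> (\<exists>w \<in> words (length As). word_product n As w = M)"

definition vector_reachable ::
  "nat \<Rightarrow> 's::{semiring_0,monoid_mult} mat list \<Rightarrow> 's mat \<Rightarrow> 's mat \<Rightarrow> bool" where
  "vector_reachable n As \<alpha> \<eta> \<longleftrightarrow> (\<exists>w \<in> words (length As). \<alpha> * word_product n As w = \<eta>)"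

definition scalar_reachable ::
  "nat \<Rightarrow> 's::{semiring_0,monoid_mult} mat list \<Rightarrow> 's mat \<Rightarrow> 's mat \<Rightarrow> 's \<Rightarrow> bool" where
  "scalar_reachable n As \<alpha> \<beta> \<gamma> \<longleftrightarrow>
     (\<exists>w \<in> words (length As). (\<alpha> * word_product n As w * \<beta>) $$ (0, 0) = \<gamma>)"

definition represents_mat :: "(tree \<Rightarrow> 's option) \<Rightarrow> tree \<Rightarrow> 's mat \<Rightarrow> bool" where
  "represents_mat \<rho> t A \<longleftrightarrow>
     (\<exists>rows. t = list_code (map list_code rows) \<and>
       map (map \<rho>) rows = map (map Some) (mat_to_list A))"

text \<open>
  The dimension \<open>n\<close> is not part of the code of an instance since it is the length of the code of
  any of the \<open>n \<times> n\<close> matrices.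
\<close>

definition matrix_reachability ::
  "(tree \<Rightarrow> 's::{semiring_0,monoid_mult} option) \<Rightarrow> nat \<Rightarrow> problem" where
  "matrix_reachability \<rho> r =
     {(list_code [list_code as, m], matrix_reachable n As M) | n As M as m.
        1 \<le> n \<and> length As = r \<and> set As \<subseteq> carrier_mat n n \<and> M \<in> carrier_mat n n \<and>
        list_all2 (represents_mat \<rho>) as As \<and> represents_mat \<rho> m M}"

definition vector_reachability ::
  "(tree \<Rightarrow> 's::{semiring_0,monoid_mult} option) \<Rightarrow> nat \<Rightarrow> problem" where
  "vector_reachability \<rho> r =
     {(list_code [list_code as, a, e], vector_reachable n As \<alpha> \<eta>) | n As \<alpha> \<eta> as a e.
        1 \<le> n \<and> length As = r \<and> set As \<subseteq> carrier_mat n n \<and>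
        \<alpha> \<in> carrier_mat 1 n \<and> \<eta> \<in> carrier_mat 1 n \<and>
        list_all2 (represents_mat \<rho>) as As \<and> represents_mat \<rho> a \<alpha> \<and> represents_mat \<rho> e \<eta>}"

definition scalar_reachability ::
  "(tree \<Rightarrow> 's::{semiring_0,monoid_mult} option) \<Rightarrow> nat \<Rightarrow> problem" where
  "scalar_reachability \<rho> r =
     {(list_code [list_code as, a, b, c], scalar_reachable n As \<alpha> \<beta> \<gamma>) | n As \<alpha> \<beta> \<gamma> as a b c.
        1 \<le> n \<and> length As = r \<and> set As \<subseteq> carrier_mat n n \<and>
        \<alpha> \<in> carrier_mat 1 n \<and> \<beta> \<in> carrier_mat n 1 \<and>
        list_all2 (represents_mat \<rho>) as As \<and> represents_mat \<rho> a \<alpha> \<and> represents_mat \<rho> b \<beta> \<and>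
        \<rho> c = Some \<gamma>}"

end

theory Submission
  imports Defs
begin

text \<open>
  Reachability asks about the semigroup generated by the given matrices: whether it contains \<open>M\<close>, or
  a \<open>P\<close> with \<open>\<alpha> P = \<eta>\<close>, or a \<open>P\<close> with \<open>\<alpha> P \<beta> = \<gamma>\<close>. All reductions are many-one. They assemble new
  matrices from the given matrices and scalars and from zero and identity matrices as blocks, so
  that computing them is list processing on codes. It remains to choose the blocks; write \<open>(x | y)\<close> for a
  row vector with two parts, on which a matrix of blocks acts as an automaton on its states.

  \<^item> One matrix fewer (\<open>prefix_code\<close>). The \<open>k + 1\<close> letters \<open>X\<close>, \<open>Y\<close>, \<open>Z\<^sub>2, \<dots>, Z\<^sub>k\<close> are coded over the
    \<open>k\<close> letters \<open>b\<^sub>1, \<dots>, b\<^sub>k\<close> by the complete prefix code \<open>b\<^sub>1 b\<^sub>1\<close>, \<open>b\<^sub>1 b\<^sub>j\<close> (\<open>j \<ge> 2\<close>), \<open>b\<^sub>j\<close>. In the double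
    dimension \<open>b\<^sub>1\<close> moves \<open>(x | 0)\<close> to \<open>(0 | x)\<close> and the second letter of a code word moves back while
    applying the decoded matrix (\<open>prefix_code_sound\<close>, \<open>prefix_code_complete\<close>). This settles vector
    reachability, because a word that stops inside a code word leads to some \<open>(0 | x)\<close>, which
    can only equal \<open>(\<eta> | 0)\<close> if both are zero (\<open>vector_prefix_code\<close>). For scalars, incomplete words
    must be told apart from complete ones: they read a constant \<open>c \<noteq> \<gamma>\<close>, chosen as \<open>0\<close> or \<open>1\<close> by the
    equality oracle (\<open>scalar_prefix_code\<close>). Conversely, repeating a matrix adds letters.

  \<^item> Scalars to vectors (\<open>scalar_as_vector\<close>). An additional letter replaces the vector \<open>\<alpha> P\<close> by the
    scalar \<open>\<alpha> P \<beta>\<close>, which no letter changes any more.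

  \<^item> Matrices to vectors (\<open>matrix_as_vector\<close>). Put the rows of a matrix side by side, and act on each
    of them by the same matrix, in a block diagonal.

  \<^item> Vectors to matrices (\<open>vector_as_matrix\<close>). An additional letter \<open>S\<close> with first row \<open>(1 | \<alpha>)\<close> and
    further rows zero is a reset: \<open>X S = S\<close> for all letters \<open>X\<close>, so that products that contain it have
    the form \<open>S P\<close>, with first row \<open>(1 | \<alpha> P)\<close>. The number of letters is brought back by the prefix
    code. There the reset also brings all rows of a product to the same state, and a single target
    matrix suffices.

  Words are not empty, so the additional letters must not give access to the vector \<open>\<alpha>\<close> itself, by
  reading off its scalar or by a final reset. For this the dimension is doubled there
  (\<open>two_copies\<close>): the first given matrix that is applied moves the vector to a second copy, which is
  where the result is expected.

  In the zero semiring, where \<open>0 = 1\<close>, the constants cannot mark anything, but there every target is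
  reachable.
\<close>

section \<open>Functions computable without oracles\<close>

text \<open>
  Closure under composition and list recursion makes it possible to describe all algorithms below as
  functions on trees. A tree is regarded as the list of the left subtrees along its right spine, which
  turns every tree into a list code.
\<close>

definition computable :: "(tree \<Rightarrow> tree) \<Rightarrow> bool" where
  "computable f \<longleftrightarrow> (\<exists>p :: oracle_id prog. \<forall>\<Gamma> x. eval \<Gamma> p x (f x))"

primrec elems :: "tree \<Rightarrow> tree list" where
  "elems Leaf = []"
| "elems (Node t ts) = t # elems ts"

lemma elems_list_code [simp]: "elems (list_code ts) = ts"
  by (induction ts) auto

lemma list_code_elems [simp]: "list_code (elems t) = t"
  by (induction t) auto

lemma computable_const: "computable (\<lambda>x. c)"
  unfolding computable_def by (blast intro: eval_Const)

lemma computable_id: "computable (\<lambda>x. x)"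
  unfolding computable_def by (blast intro: eval_Id)

lemma computable_comp:
  assumes "computable f" "computable g"
  shows "computable (\<lambda>x. g (f x))"
proof -
  from assms obtain p q :: "oracle_id prog" where
    "\<And>\<Gamma> x. eval \<Gamma> p x (f x)" "\<And>\<Gamma> x. eval \<Gamma> q x (g x)" unfolding computable_def by metis
  then have "eval \<Gamma> (Seq p q) x (g (f x))" for \<Gamma> x by (blast intro: eval_Seq)
  then show ?thesis unfolding computable_def by blast
qed

lemma computable_left: "computable f \<Longrightarrow> computable (\<lambda>x. left (f x))"
proof (erule computable_comp)
  show "computable left" unfolding computable_def by (blast intro: eval_Left)
qed

lemma computable_right: "computable f \<Longrightarrow> computable (\<lambda>x. right (f x))"
proof (erule computable_comp)
  show "computable right" unfolding computable_def by (blast intro: eval_Right)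
qed

lemma computable_Node:
  assumes "computable f" "computable g"
  shows "computable (\<lambda>x. Node (f x) (g x))"
proof -
  from assms obtain p q :: "oracle_id prog" where
    "\<And>\<Gamma> x. eval \<Gamma> p x (f x)" "\<And>\<Gamma> x. eval \<Gamma> q x (g x)" unfolding computable_def by metis
  then have "eval \<Gamma> (Pair p q) x (Node (f x) (g x))" for \<Gamma> x by (blast intro: eval_Pair)
  then show ?thesis unfolding computable_def by blast
qed

lemmas computable_basic = computable_const computable_id computable_left computable_right computable_Node

text \<open>
  The loop works on triples of the environment \<open>x\<close>, the accumulator and the remaining list. The
  environment lets \<open>g\<close> refer to the whole input, since programs have no variables.
\<close>

lemma computable_foldl:
  assumes g: "computable (\<lambda>t. g (left t) (left (right t)) (right (right t)))"
    and s: "computable s" and l: "computable l"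
  shows "computable (\<lambda>x. foldl (g x) (s x) (elems (l x)))"
proof -
  define body where "body t = Node (left t) (Node
    (g (left t) (left (right t)) (left (right (right t)))) (right (right (right t))))" for t
  have "computable (\<lambda>t. g (left t) (left (right t)) (left (right (right t))))"
  proof -
    have "computable (\<lambda>t. Node (left t) (Node (left (right t)) (left (right (right t)))))"
      by (intro computable_basic)
    from computable_comp[OF this g] show ?thesis by simp
  qed
  then have "computable body"
    unfolding body_def by (intro computable_basic)
  then obtain p :: "oracle_id prog" where p: "\<And>\<Gamma> x. eval \<Gamma> p x (body x)" unfolding computable_def by metis
  let ?loop = "While (Seq Right Right) p"
  have test: "eval \<Gamma> (Seq Right Right) (Node x (Node a r)) r" for \<Gamma> :: "oracle_id \<Rightarrow> _" and x a r
    using eval_Seq[OF eval_Right eval_Right, of \<Gamma> "Node x (Node a r)"] by simp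
  have loop: "eval \<Gamma> ?loop (Node x (Node a r)) (Node x (Node (foldl (g x) a (elems r)) Leaf))"
    for \<Gamma> x a r
  proof (induction r arbitrary: a)
    case Leaf
    then show ?case using eval_While_done[OF test] by simp
  next
    case (Node y r)
    have "eval \<Gamma> p (Node x (Node a (Node y r))) (Node x (Node (g x a y) r))"
      using p[of \<Gamma> "Node x (Node a (Node y r))"] by (simp add: body_def)
    then show ?case using eval_While_step[OF test] Node.IH(2) by auto
  qed
  have "computable (\<lambda>x. Node x (Node (s x) (l x)))" using s l by (intro computable_basic)
  then obtain q :: "oracle_id prog" where "\<And>\<Gamma> x. eval \<Gamma> q x (Node x (Node (s x) (l x)))"
    unfolding computable_def by metis
  then have "eval \<Gamma> (Seq q ?loop) x (Node x (Node (foldl (g x) (s x) (elems (l x))) Leaf))" for \<Gamma> x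
    using loop by (blast intro: eval_Seq)
  then have "computable (\<lambda>x. Node x (Node (foldl (g x) (s x) (elems (l x))) Leaf))"
    unfolding computable_def by blast
  from computable_left[OF computable_right[OF this]] show ?thesis by simp
qed

lemma computable_rev:
  assumes "computable l"
  shows "computable (\<lambda>x. list_code (rev (elems (l x))))"
proof -
  have "foldl (\<lambda>s y. Node y s) a ts = list_code (rev ts @ elems a)" for a ts
    by (induction ts arbitrary: a) auto
  from this[of Leaf] have eq: "list_code (rev ts) = foldl (\<lambda>s y. Node y s) Leaf ts" for ts by simp
  show ?thesis unfolding eq by (intro computable_foldl computable_basic assms)
qed

lemma computable_append:
  assumes "computable l" "computable m"
  shows "computable (\<lambda>x. list_code (elems (l x) @ elems (m x)))"
proof -
  have "foldl (\<lambda>s y. Node y s) a ts = list_code (rev ts @ elems a)" for a ts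
    by (induction ts arbitrary: a) auto
  from this[of _ "rev _"] have eq: "list_code (elems s @ elems t) =
    foldl (\<lambda>s y. Node y s) t (elems (list_code (rev (elems s))))" for s t by simp
  show ?thesis unfolding eq by (intro computable_foldl computable_basic computable_rev assms)
qed

lemma computable_map:
  assumes h: "computable (\<lambda>t. h (left t) (right t))" and l: "computable l"
  shows "computable (\<lambda>x. list_code (map (h x) (elems (l x))))"
proof -
  have "foldl (\<lambda>s y. Node (f y) s) a ts = list_code (rev (map f ts) @ elems a)" for f a ts
    by (induction ts arbitrary: a) auto
  \<comment> \<open>Consing reverses the list, so it is reversed beforehand.\<close>
  from this[of "h _" Leaf "rev _"] have eq: "list_code (map (h x) (elems t)) =
    foldl (\<lambda>s y. Node (h x y) s) Leaf (elems (list_code (rev (elems t))))" for x t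
    by (simp add: rev_map)
  have "computable (\<lambda>t. h (left t) (right (right t)))"
  proof -
    have "computable (\<lambda>t. Node (left t) (right (right t)))" by (intro computable_basic)
    from computable_comp[OF this h] show ?thesis by simp
  qed
  then show ?thesis
    unfolding eq by (intro computable_foldl computable_basic computable_rev l)
qed

section \<open>Many-one reductions\<close>

text \<open>
  The equality oracle may be used by the reduction, which is why the arithmetic oracles are in scope.
\<close>

definition many_one :: "(tree \<Rightarrow> 's::{semiring_0,monoid_mult} option) \<Rightarrow> problem \<Rightarrow> problem \<Rightarrow> bool" where
  "many_one \<rho> P' P \<longleftrightarrow> (\<exists>p. \<forall>\<Gamma>. arithmetic_oracles \<rho> \<Gamma> \<longrightarrow>
     (\<forall>(t, b) \<in> P'. \<exists>u. eval \<Gamma> p t u \<and> (u, b) \<in> P))"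

lemma many_one_imp_reduces:
  assumes "many_one \<rho> P' P"
  shows "reduces \<rho> P' P"
proof -
  from assms obtain p where p: "\<And>\<Gamma> t b. arithmetic_oracles \<rho> \<Gamma> \<Longrightarrow> (t, b) \<in> P' \<Longrightarrow>
    \<exists>u. eval \<Gamma> p t u \<and> (u, b) \<in> P" unfolding many_one_def by blast
  have "solves \<Gamma> (Seq p (Call Problem_Oracle)) P'"
    if "arithmetic_oracles \<rho> \<Gamma>" "problem_oracle P \<Gamma>" for \<Gamma>
    using p[OF that(1)] that(2) unfolding solves_def problem_oracle_def
    by (fastforce intro: eval_Seq eval_Call)
  then show ?thesis unfolding reduces_def by blast
qed

lemma many_one_refl: "many_one \<rho> P P"
  unfolding many_one_def by (rule exI[of _ Id]) (blast intro: eval_Id)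

lemma many_one_trans:
  assumes "many_one \<rho> P Q" "many_one \<rho> Q R"
  shows "many_one \<rho> P R"
proof -
  from assms(1) obtain p where p: "\<And>\<Gamma> t b. arithmetic_oracles \<rho> \<Gamma> \<Longrightarrow> (t, b) \<in> P \<Longrightarrow>
    \<exists>u. eval \<Gamma> p t u \<and> (u, b) \<in> Q" unfolding many_one_def by blast
  from assms(2) obtain q where q: "\<And>\<Gamma> t b. arithmetic_oracles \<rho> \<Gamma> \<Longrightarrow> (t, b) \<in> Q \<Longrightarrow>
    \<exists>u. eval \<Gamma> q t u \<and> (u, b) \<in> R" unfolding many_one_def by blast
  have "\<exists>u. eval \<Gamma> (Seq p q) t u \<and> (u, b) \<in> R" if "arithmetic_oracles \<rho> \<Gamma>" "(t, b) \<in> P" for \<Gamma> t b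
    using p[OF that] q[OF that(1)] by (blast intro: eval_Seq)
  then show ?thesis unfolding many_one_def by blast
qed

lemma many_one_computable:
  assumes "computable f" "\<And>t b. (t, b) \<in> P' \<Longrightarrow> (f t, b) \<in> P"
  shows "many_one \<rho> P' P"
  using assms unfolding computable_def many_one_def by blast

section \<open>Matrices with blocks over a semiring\<close>

text \<open>
  The neutrality of the identity matrix also holds in the zero semiring, where \<open>0 = 1\<close>.
\<close>

lemma one_mult_mat: "(A :: 'a::{semiring_0,monoid_mult} mat) \<in> carrier_mat m n \<Longrightarrow> 1\<^sub>m m * A = A"
  by (intro eq_matI)
    (auto simp: scalar_prod_def one_mat_def if_distrib[of "\<lambda>x. x * _"] sum.If_cases cong: if_cong)

lemma mult_one_mat: "(A :: 'a::{semiring_0,monoid_mult} mat) \<in> carrier_mat m n \<Longrightarrow> A * 1\<^sub>m n = A"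
  by (intro eq_matI)
    (auto simp: scalar_prod_def one_mat_def if_distrib[of "\<lambda>x. _ * x"] sum.If_cases cong: if_cong)

text \<open>
  \<open>(A | B)\<close> is encoded as a degenerate block matrix, so that the multiplication of block matrices also
  covers its products with them.
\<close>

definition hcat :: "'a::zero mat \<Rightarrow> 'a mat \<Rightarrow> 'a mat" where
  "hcat A B = four_block_mat A B (0\<^sub>m 0 (dim_col A)) (0\<^sub>m 0 (dim_col B))"

lemma hcat_carrier [simp]:
  "A \<in> carrier_mat p n \<Longrightarrow> B \<in> carrier_mat p m \<Longrightarrow> hcat A B \<in> carrier_mat p (n + m)"
  by (auto simp: hcat_def)

lemma hcat_mult_block:
  fixes u :: "'a::semiring_0 mat"
  assumes "u \<in> carrier_mat p n" "v \<in> carrier_mat p m"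
    "A \<in> carrier_mat n n'" "B \<in> carrier_mat n m'" "C \<in> carrier_mat m n'" "D \<in> carrier_mat m m'"
  shows "hcat u v * four_block_mat A B C D = hcat (u * A + v * C) (u * B + v * D)"
proof -
  have z: "0\<^sub>m 0 n \<in> carrier_mat 0 n" "0\<^sub>m 0 m \<in> carrier_mat 0 m" for n m by auto
  show ?thesis
    using mult_four_block_mat[OF assms(1,2) z assms(3-6)] assms
    by (simp add: hcat_def)
qed

lemma hcat_mult_append_rows:
  fixes u :: "'a::semiring_0 mat"
  assumes "u \<in> carrier_mat p n" "v \<in> carrier_mat p m" "x \<in> carrier_mat n k" "y \<in> carrier_mat m k"
  shows "hcat u v * (x @\<^sub>r y) = u * x + v * y"
proof -
  have z: "0\<^sub>m 0 n \<in> carrier_mat 0 n" "0\<^sub>m 0 m \<in> carrier_mat 0 m" 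
    "0\<^sub>m n 0 \<in> carrier_mat n 0" "0\<^sub>m m 0 \<in> carrier_mat m 0" by auto
  show ?thesis
    using mult_four_block_mat[OF assms(1,2) z(1,2) assms(3) z(3) assms(4) z(4)] assms
    apply (simp add: hcat_def append_rows_def)
    apply (intro eq_matI) apply auto
    done
qed

lemma append_rows_mult:
  fixes A :: "'a::semiring_0 mat"
  assumes "A \<in> carrier_mat p n" "B \<in> carrier_mat q n" "C \<in> carrier_mat n m"
  shows "(A @\<^sub>r B) * C = (A * C) @\<^sub>r (B * C)"
  using assms by (intro eq_matI) (auto simp: append_rows_def scalar_prod_def)

lemma hcat_inject:
  assumes "u \<in> carrier_mat p n" "u' \<in> carrier_mat p n" "v \<in> carrier_mat p m" "v' \<in> carrier_mat p m"
  shows "hcat u v = hcat u' v' \<longleftrightarrow> u = u' \<and> v = v'"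
proof
  assume eq: "hcat u v = hcat u' v'"
  have "u $$ (i, j) = u' $$ (i, j)" if "i < p" "j < n" for i j
    using arg_cong[OF eq, of "\<lambda>A. A $$ (i, j)"] that assms by (simp add: hcat_def)
  moreover have "v $$ (i, j) = v' $$ (i, j)" if "i < p" "j < m" for i j
    using arg_cong[OF eq, of "\<lambda>A. A $$ (i, n + j)"] that assms by (simp add: hcat_def)
  ultimately show "u = u' \<and> v = v'"
    using assms by (auto intro!: eq_matI)
qed simp

lemma block_eq_append_rows_hcat:
  assumes "A \<in> carrier_mat n n'" "B \<in> carrier_mat n m'" "C \<in> carrier_mat m n'" "D \<in> carrier_mat m m'"
  shows "four_block_mat A B C D = hcat A B @\<^sub>r hcat C D"
  using assms by (intro eq_matI) (auto simp: hcat_def append_rows_def)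

text \<open>
  The number of rows of a row vector is written \<open>1\<close>, and has to stay in this form to match the
  carrier sets below.
\<close>

declare One_nat_def [simp del]

definition block_diag :: "'a::zero mat \<Rightarrow> 'a mat \<Rightarrow> 'a mat" where
  "block_diag A D = four_block_mat A (0\<^sub>m (dim_row A) (dim_col D)) (0\<^sub>m (dim_row D) (dim_col A)) D"

text \<open>
  Maps \<open>(x | y)\<close> to \<open>(0 | x A + y A)\<close>. From \<open>(\<alpha> | 0)\<close>, nonempty products \<open>P\<close> lead to \<open>(0 | \<alpha> P)\<close>,
  while the empty product leaves the vector in the first part.
\<close>

definition two_copies :: "'a::zero mat \<Rightarrow> 'a mat" where
  "two_copies A = four_block_mat (0\<^sub>m (dim_row A) (dim_col A)) A (0\<^sub>m (dim_row A) (dim_col A)) A"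

lemma block_diag_carrier [simp]:
  "A \<in> carrier_mat m n \<Longrightarrow> D \<in> carrier_mat p q \<Longrightarrow> block_diag A D \<in> carrier_mat (m + p) (n + q)"
  by (auto simp: block_diag_def)

lemma two_copies_carrier [simp]: "A \<in> carrier_mat m n \<Longrightarrow> two_copies A \<in> carrier_mat (m + m) (n + n)"
  by (auto simp: two_copies_def)

lemma block_diag_mult:
  fixes A :: "'a::semiring_0 mat"
  assumes "A \<in> carrier_mat n n" "B \<in> carrier_mat n n" "C \<in> carrier_mat m m" "D \<in> carrier_mat m m"
  shows "block_diag A C * block_diag B D = block_diag (A * B) (C * D)"
proof -
  have z: "0\<^sub>m n m \<in> carrier_mat n m" "0\<^sub>m m n \<in> carrier_mat m n" by auto
  show ?thesis
    using mult_four_block_mat[OF assms(1) z(1,2) assms(3,2) z(1,2) assms(4)] assms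
    by (simp add: block_diag_def)
qed

lemma two_copies_mult:
  fixes A :: "'a::semiring_0 mat"
  assumes "A \<in> carrier_mat n n" "B \<in> carrier_mat n n"
  shows "two_copies A * two_copies B = two_copies (A * B)"
proof -
  have z: "0\<^sub>m n n \<in> carrier_mat n n" by auto
  show ?thesis
    using mult_four_block_mat[OF z assms(1) z assms(1) z assms(2) z assms(2)] assms
    by (simp add: two_copies_def)
qed

lemma hcat_mult_block_diag:
  fixes u :: "'a::semiring_0 mat"
  assumes "u \<in> carrier_mat p n" "v \<in> carrier_mat p m" "A \<in> carrier_mat n n'" "D \<in> carrier_mat m m'"
  shows "hcat u v * block_diag A D = hcat (u * A) (v * D)"
  using hcat_mult_block[OF assms(1-3) zero_carrier_mat zero_carrier_mat assms(4)] assms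
  by (simp add: block_diag_def)

lemma hcat_mult_two_copies:
  fixes u :: "'a::semiring_0 mat"
  assumes "u \<in> carrier_mat p n" "v \<in> carrier_mat p n" "A \<in> carrier_mat n n'"
  shows "hcat u v * two_copies A = hcat (0\<^sub>m p n') (u * A + v * A)"
  using hcat_mult_block[OF assms(1,2) zero_carrier_mat assms(3) zero_carrier_mat assms(3)] assms
  by (simp add: two_copies_def)

section \<open>The semigroup generated by a set of matrices\<close>

lemma trivial_semiring: "(1::'a::{semiring_0,monoid_mult}) = 0 \<Longrightarrow> (a::'a) = b"
  by (metis mult_1_left mult_zero_left)

text \<open>
  Products are nonempty, as in the reachability problems. They grow on the right since row vectors are
  acted on from the right.
\<close>

inductive_set generated :: "'a::semiring_0 mat set \<Rightarrow> 'a mat set" for S where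
  generator: "A \<in> S \<Longrightarrow> A \<in> generated S"
| snoc: "P \<in> generated S \<Longrightarrow> A \<in> S \<Longrightarrow> P * A \<in> generated S"

lemma generated_carrier:
  assumes "S \<subseteq> carrier_mat n n" "P \<in> generated S"
  shows "P \<in> carrier_mat n n"
  using assms(2) by induction (use assms(1) in auto)

lemma generated_mult:
  assumes S: "S \<subseteq> carrier_mat n n" and P: "P \<in> generated S" and Q: "Q \<in> generated S"
  shows "P * Q \<in> generated S"
  using Q
proof induction
  case (generator A)
  then show ?case by (rule generated.snoc[OF P])
next
  case (snoc Q A)
  have "P * (Q * A) = P * Q * A"
    using S snoc.hyps generated_carrier[OF S] P by (intro assoc_mult_mat[symmetric, of _ n n _ n _ n]) auto
  then show ?case using snoc by (simp add: generated.snoc)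
qed

lemma generated_mono:
  assumes "S \<subseteq> T" "P \<in> generated S"
  shows "P \<in> generated T"
  using assms(2) by induction (use assms(1) in \<open>auto intro: generated.intros\<close>)

lemma word_products_eq_generated:
  assumes "set As \<subseteq> carrier_mat n n"
  shows "word_product n As ` words (length As) = generated (set As)"
proof -
  have letter: "As ! i * 1\<^sub>m n = As ! i" if "i < length As" for i
    using that assms by (intro mult_one_mat[of _ n]) auto
  have carrier: "word_product n As w \<in> carrier_mat n n" if "set w \<subseteq> {..<length As}" for w
    using that assms by (induction w) (auto simp: word_product_def intro!: mult_carrier_mat[of _ n n])
  have "word_product n As w \<in> generated (set As)" if "w \<noteq> []" "set w \<subseteq> {..<length As}" for w
    using that
  proof (induction w rule: list_nonempty_induct)
    case (single i)
    then show ?case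
      by (auto simp: word_product_def letter intro!: generator)
  next
    case (cons i w)
    then show ?case
      using generated_mult[OF assms generator[of "As ! i"]] by (simp add: word_product_def)
  qed
  moreover have "P \<in> word_product n As ` words (length As)" if "P \<in> generated (set As)" for P
    using that
  proof induction
    case (generator A)
    then obtain i where "i < length As" "A = As ! i" by (auto simp: in_set_conv_nth)
    then show ?case
      using letter
      by (intro image_eqI[of _ _ "[i]"]) (auto simp: word_product_def words_def)
  next
    case (snoc P A)
    then obtain i w where iw: "i < length As" "A = As ! i" "w \<in> words (length As)"
      "P = word_product n As w" by (auto simp: in_set_conv_nth)
    have A: "A \<in> carrier_mat n n" using snoc assms by auto
    have "word_product n As (v @ [i]) = word_product n As v * A" if "set v \<subseteq> {..<length As}" for v
      using that
    proof (induction v)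
      case Nil
      then show ?case using A iw(2) by (simp add: word_product_def one_mult_mat mult_one_mat)
    next
      case (Cons j v)
      then have "As ! j \<in> carrier_mat n n" using assms by auto
      then have "As ! j * word_product n As v * A = As ! j * (word_product n As v * A)"
        using Cons carrier[of v] A by (intro assoc_mult_mat) auto
      then show ?case using Cons by (simp add: word_product_def)
    qed
    then show ?case using iw by (intro image_eqI[of _ _ "w @ [i]"]) (auto simp: words_def)
  qed
  ultimately show ?thesis by (auto simp: words_def)
qed

lemma reachable_iff_generated:
  assumes "set As \<subseteq> carrier_mat n n"
  shows "matrix_reachable n As M \<longleftrightarrow> M \<in> generated (set As)"
    and "vector_reachable n As \<alpha> \<eta> \<longleftrightarrow> (\<exists>P \<in> generated (set As). \<alpha> * P = \<eta>)"
    and "scalar_reachable n As \<alpha> \<beta> \<gamma> \<longleftrightarrow> (\<exists>P \<in> generated (set As). (\<alpha> * P * \<beta>) $$ (0, 0) = \<gamma>)"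
  unfolding matrix_reachable_def vector_reachable_def scalar_reachable_def
    word_products_eq_generated[OF assms, symmetric] by auto

text \<open>
  Several constructions replace each matrix by a larger one through a multiplicative map. The products
  of the new matrices are then the images of the old products.
\<close>

lemma generated_image:
  assumes S: "S \<subseteq> carrier_mat n n"
    and hom: "\<And>P A. P \<in> carrier_mat n n \<Longrightarrow> A \<in> carrier_mat n n \<Longrightarrow> f (P * A) = f P * f A"
  shows "generated (f ` S) = f ` generated S"
proof (intro equalityI subsetI)
  fix Q assume "Q \<in> generated (f ` S)"
  then show "Q \<in> f ` generated S"
  proof induction
    case (snoc Q B)
    then obtain P A where "P \<in> generated S" "Q = f P" "A \<in> S" "B = f A" by auto
    then show ?case
      using hom[of P A] generated_carrier[OF S] S by (intro image_eqI[of _ _ "P * A"]) (auto intro: generated.snoc)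
  qed (auto intro: generator)
next
  fix Q assume "Q \<in> f ` generated S"
  then obtain P where "P \<in> generated S" "Q = f P" by auto
  then show "Q \<in> generated (f ` S)"
  proof (induction arbitrary: Q)
    case (snoc P A)
    then have "f (P * A) = f P * f A" using hom generated_carrier[OF S] S by blast
    then show ?case using snoc by (auto intro: generated.snoc)
  qed (auto intro: generator)
qed

lemma mult_inner_assoc:
  fixes u :: "'a::semiring_0 mat"
  assumes "u \<in> carrier_mat p n" "S \<subseteq> carrier_mat n n" "Q \<in> generated S" "A \<in> S"
  shows "u * (Q * A) = u * Q * A"
  using assms generated_carrier[OF assms(2,3)] by (intro assoc_mult_mat[symmetric, of _ p n _ n _ n]) auto

section \<open>One matrix fewer by a prefix code\<close>

text \<open>
  The state after complete code words is \<open>(x | 0)\<close>. The letter \<open>code_head X\<close> starts a code word of length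
  two, \<open>(x | 0) \<mapsto> (0 | x)\<close>, and as a second letter it applies \<open>X\<close>, \<open>(0 | x) \<mapsto> (x X | 0)\<close>. The letter
  \<open>code_tail Y Z\<close> applies \<open>Z\<close> as a code word of its own and \<open>Y\<close> as a second letter.
\<close>

definition code_head :: "'a::{zero,one} mat \<Rightarrow> 'a mat" where
  "code_head X = four_block_mat (0\<^sub>m (dim_row X) (dim_row X)) (1\<^sub>m (dim_row X)) X (0\<^sub>m (dim_row X) (dim_row X))"

definition code_tail :: "'a::zero mat \<Rightarrow> 'a mat \<Rightarrow> 'a mat" where
  "code_tail Y Z = four_block_mat Z (0\<^sub>m (dim_row Z) (dim_row Y)) Y (0\<^sub>m (dim_row Y) (dim_row Y))"

text \<open>
  Two matrices are turned into one that applies only \<open>X\<close>; coding is faithful if there are at least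
  three, since \<open>Y\<close> is applied by the tail letters.
\<close>

fun prefix_code :: "'a::{zero,one} mat list \<Rightarrow> 'a mat list" where
  "prefix_code (X # Y # Zs) = code_head X # map (code_tail Y) Zs"
| "prefix_code As = As"

lemma code_carrier [simp]:
  "X \<in> carrier_mat n n \<Longrightarrow> code_head X \<in> carrier_mat (n + n) (n + n)"
  "Y \<in> carrier_mat n n \<Longrightarrow> Z \<in> carrier_mat n n \<Longrightarrow> code_tail Y Z \<in> carrier_mat (n + n) (n + n)"
  by (auto simp: code_head_def code_tail_def)

lemma hcat_mult_code_head:
  fixes x :: "'a::{semiring_0,monoid_mult} mat"
  assumes x: "x \<in> carrier_mat p n" and X: "X \<in> carrier_mat n n"
  shows "hcat x (0\<^sub>m p n) * code_head X = hcat (0\<^sub>m p n) x"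
    and "hcat (0\<^sub>m p n) x * code_head X = hcat (x * X) (0\<^sub>m p n)"
proof -
  have z: "0\<^sub>m m n \<in> carrier_mat m n" for m by auto
  have o: "1\<^sub>m n \<in> carrier_mat n n" by auto
  have "x * X \<in> carrier_mat p n" using x X by auto
  then show "hcat x (0\<^sub>m p n) * code_head X = hcat (0\<^sub>m p n) x"
    and "hcat (0\<^sub>m p n) x * code_head X = hcat (x * X) (0\<^sub>m p n)"
    using hcat_mult_block[OF x z z o X z] hcat_mult_block[OF z x z o X z] x X
    by (simp_all add: code_head_def mult_one_mat[OF x])
qed

lemma hcat_mult_code_tail:
  fixes x :: "'a::{semiring_0,monoid_mult} mat"
  assumes x: "x \<in> carrier_mat p n" and Y: "Y \<in> carrier_mat n n" and Z: "Z \<in> carrier_mat n n"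
  shows "hcat x (0\<^sub>m p n) * code_tail Y Z = hcat (x * Z) (0\<^sub>m p n)"
    and "hcat (0\<^sub>m p n) x * code_tail Y Z = hcat (x * Y) (0\<^sub>m p n)"
proof -
  have z: "0\<^sub>m m n \<in> carrier_mat m n" for m by auto
  have "x * Y \<in> carrier_mat p n" "x * Z \<in> carrier_mat p n" using x Y Z by auto
  then show "hcat x (0\<^sub>m p n) * code_tail Y Z = hcat (x * Z) (0\<^sub>m p n)"
    and "hcat (0\<^sub>m p n) x * code_tail Y Z = hcat (x * Y) (0\<^sub>m p n)"
    using hcat_mult_block[OF x z Z z Y z] hcat_mult_block[OF z x Z z Y z] x Y Z
    by (simp_all add: code_tail_def)
qed

lemma length_prefix_code: "length As \<ge> 2 \<Longrightarrow> length (prefix_code As) = length As - 1"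
  by (cases As rule: prefix_code.cases) auto

lemma prefix_code_carrier:
  assumes "set As \<subseteq> carrier_mat n n" "length As \<ge> 2"
  shows "set (prefix_code As) \<subseteq> carrier_mat (n + n) (n + n)"
  using assms by (cases As rule: prefix_code.cases) auto

text \<open>
  Every word over the new letters is a sequence of code words, possibly followed by the beginning of
  one. The empty sequence only occurs in the second case, since the word itself is nonempty. The factor
  \<open>u\<close> may have several rows: the rows evolve in parallel.
\<close>

lemma prefix_code_sound:
  fixes As :: "'a::{semiring_0,monoid_mult} mat list"
  assumes As: "set As \<subseteq> carrier_mat n n" "length As \<ge> 2"
    and u: "u \<in> carrier_mat p n" and Q: "Q \<in> generated (set (prefix_code As))"
  shows "(\<exists>P \<in> generated (set As). hcat u (0\<^sub>m p n) * Q = hcat (u * P) (0\<^sub>m p n)) \<or>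
    (\<exists>P \<in> insert (1\<^sub>m n) (generated (set As)). hcat u (0\<^sub>m p n) * Q = hcat (0\<^sub>m p n) (u * P))"
proof -
  obtain X Y Zs where XYZ: "As = X # Y # Zs"
    using As(2) by (cases As rule: prefix_code.cases) auto
  have dims: "X \<in> carrier_mat n n" "Y \<in> carrier_mat n n" "\<And>Z. Z \<in> set Zs \<Longrightarrow> Z \<in> carrier_mat n n"
    using As XYZ by auto
  have code: "set (prefix_code As) = insert (code_head X) (code_tail Y ` set Zs)"
    by (simp add: XYZ)
  note B = hcat_mult_code_head[OF _ dims(1)]
  note C = hcat_mult_code_tail[OF _ dims(2) dims(3)]
  have S': "set (prefix_code As) \<subseteq> carrier_mat (n + n) (n + n)" using As by (rule prefix_code_carrier)
  have assoc: "hcat u (0\<^sub>m p n) * (Q * D) = hcat u (0\<^sub>m p n) * Q * D"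
    if "Q \<in> generated (set (prefix_code As))" "D \<in> set (prefix_code As)" for Q D
    using that S' generated_carrier[OF S'] u
    by (intro assoc_mult_mat[symmetric, of _ p "n + n" _ "n + n" _ "n + n"]) auto
  have uP: "u * P \<in> carrier_mat p n" "\<And>A. A \<in> set As \<Longrightarrow> u * P * A = u * (P * A)"
    if "P \<in> insert (1\<^sub>m n) (generated (set As))" for P
  proof -
    have P: "P \<in> carrier_mat n n" using that generated_carrier[OF As(1)] by auto
    then show "u * P \<in> carrier_mat p n" using u by auto
    fix A assume "A \<in> set As"
    then show "u * P * A = u * (P * A)" using P u As by (intro assoc_mult_mat[of _ p n _ n _ n]) auto
  qed
  show ?thesis
    using Q
  proof induction
    case (generator D)
    then consider "D = code_head X" | Z where "Z \<in> set Zs" "D = code_tail Y Z" by (auto simp: code)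
    then show ?case
    proof cases
      case 1
      then show ?thesis using B(1)[OF u] u by (intro disjI2 bexI[of _ "1\<^sub>m n"]) (auto simp: mult_one_mat)
    next
      case 2
      then show ?thesis
        using C(1)[OF u] by (intro disjI1 bexI[of _ Z]) (auto simp: XYZ intro: generated.generator)
    qed
  next
    case (snoc Q D)
    have snoc': "P * A \<in> generated (set As)" if "P \<in> insert (1\<^sub>m n) (generated (set As))" "A \<in> set As" for P A
      using that As(1) by (auto simp: one_mult_mat[of A n n] subset_iff intro: generated.intros)
    from snoc.hyps(2) consider "D = code_head X" | Z where "Z \<in> set Zs" "D = code_tail Y Z" by (auto simp: code)
    note cases = this
    from snoc.IH show ?case
    proof (elim disjE bexE)
      fix P assume P: "P \<in> generated (set As)" "hcat u (0\<^sub>m p n) * Q = hcat (u * P) (0\<^sub>m p n)"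
      from cases show ?thesis
      proof cases
        case 1
        then show ?thesis
          unfolding assoc[OF snoc.hyps] P(2) using B(1)[OF uP(1)] P(1) by (intro disjI2) auto
      next
        case 2
        then show ?thesis
          unfolding assoc[OF snoc.hyps] P(2) using C(1)[OF uP(1)] uP(2) P(1) snoc'
          by (intro disjI1 bexI[of _ "P * Z"]) (auto simp: XYZ)
      qed
    next
      fix P assume P: "P \<in> insert (1\<^sub>m n) (generated (set As))" "hcat u (0\<^sub>m p n) * Q = hcat (0\<^sub>m p n) (u * P)"
      from cases show ?thesis
      proof cases
        case 1
        then show ?thesis
          unfolding assoc[OF snoc.hyps] P(2) using B(2)[OF uP(1)] uP(2) P(1) snoc'
          by (intro disjI1 bexI[of _ "P * X"]) (simp_all add: XYZ)
      next
        case 2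
        then show ?thesis
          unfolding assoc[OF snoc.hyps] P(2) using C(2)[OF uP(1)] uP(2) P(1) snoc'
          by (intro disjI1 bexI[of _ "P * Y"]) (simp_all add: XYZ)
      qed
    qed
  qed
qed

text \<open>
  Write \<open>P\<close> as a product of matrices from \<open>As\<close>, and let \<open>Q\<close> be the product of their code words.
\<close>

lemma prefix_code_complete:
  fixes As :: "'a::{semiring_0,monoid_mult} mat list"
  assumes As: "set As \<subseteq> carrier_mat n n" "length As \<ge> 3" and P: "P \<in> generated (set As)"
  shows "\<exists>Q \<in> generated (set (prefix_code As)). \<forall>p. \<forall>u \<in> carrier_mat p n.
    hcat u (0\<^sub>m p n) * Q = hcat (u * P) (0\<^sub>m p n)"
proof -
  obtain X Y Z0 Zs' where "As = X # Y # Z0 # Zs'"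
    using As(2) by (cases As rule: prefix_code.cases) (auto simp: Suc_le_length_iff numeral_eq_Suc)
  then obtain Zs where XYZ: "As = X # Y # Zs" and Z0: "Z0 \<in> set Zs" by auto
  have dims: "X \<in> carrier_mat n n" "Y \<in> carrier_mat n n" "\<And>Z. Z \<in> set Zs \<Longrightarrow> Z \<in> carrier_mat n n"
    using As XYZ by auto
  have code: "set (prefix_code As) = insert (code_head X) (code_tail Y ` set Zs)"
    by (simp add: XYZ)
  note B = hcat_mult_code_head[OF _ dims(1)]
  note C = hcat_mult_code_tail[OF _ dims(2) dims(3)]
  have S': "set (prefix_code As) \<subseteq> carrier_mat (n + n) (n + n)"
    using As by (intro prefix_code_carrier) auto
  have letter: "\<exists>Q \<in> generated (set (prefix_code As)). \<forall>p. \<forall>u \<in> carrier_mat p n.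
    hcat u (0\<^sub>m p n) * Q = hcat (u * A) (0\<^sub>m p n)" if "A \<in> set As" for A
  proof -
    have BD: "hcat u (0\<^sub>m p n) * (code_head X * D) = hcat (0\<^sub>m p n) u * D"
      if "u \<in> carrier_mat p n" "D \<in> set (prefix_code As)" for u p D
      using assoc_mult_mat[of "hcat u (0\<^sub>m p n)" p "n + n" "code_head X" "n + n" D "n + n"] B(1)[OF that(1)] S' that
      by (auto simp: code)
    have in_code: "code_head X \<in> set (prefix_code As)" "code_tail Y Z0 \<in> set (prefix_code As)" using Z0 by (auto simp: code)
    from that consider "A = X" | "A = Y" | "A \<in> set Zs" by (auto simp: XYZ)
    then show ?thesis
    proof cases
      case 1
      then show ?thesis
        using BD B(2) in_code by (intro bexI[of _ "code_head X * code_head X"]) (auto intro: generated.intros)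
    next
      case 2
      then show ?thesis
        using BD C(2) in_code Z0 by (intro bexI[of _ "code_head X * code_tail Y Z0"]) (auto intro: generated.intros)
    next
      case 3
      then show ?thesis
        using C(1) by (intro bexI[of _ "code_tail Y A"]) (auto simp: code intro: generated.intros)
    qed
  qed
  show ?thesis
    using P
  proof induction
    case (generator A)
    then show ?case by (rule letter)
  next
    case (snoc P A)
    from snoc.IH obtain Q where Q: "Q \<in> generated (set (prefix_code As))"
      "\<And>p u. u \<in> carrier_mat p n \<Longrightarrow> hcat u (0\<^sub>m p n) * Q = hcat (u * P) (0\<^sub>m p n)" by blast
    from letter[OF snoc.hyps(2)] obtain R where R: "R \<in> generated (set (prefix_code As))"
      "\<And>p u. u \<in> carrier_mat p n \<Longrightarrow> hcat u (0\<^sub>m p n) * R = hcat (u * A) (0\<^sub>m p n)" by blast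
    have PA: "P \<in> carrier_mat n n" "A \<in> carrier_mat n n"
      using snoc.hyps As generated_carrier[OF As(1)] by auto
    have "hcat u (0\<^sub>m p n) * (Q * R) = hcat (u * (P * A)) (0\<^sub>m p n)" if u: "u \<in> carrier_mat p n" for p u
    proof -
      have "hcat u (0\<^sub>m p n) * (Q * R) = hcat u (0\<^sub>m p n) * Q * R"
        using u Q(1) R(1) generated_carrier[OF S']
        by (intro assoc_mult_mat[symmetric, of _ p "n + n" _ "n + n" _ "n + n"]) auto
      also have "\<dots> = hcat (u * P * A) (0\<^sub>m p n)"
        using Q(2)[OF u] R(2)[of "u * P" p] u PA by simp
      also have "u * P * A = u * (P * A)"
        using u PA by (intro assoc_mult_mat) auto
      finally show ?thesis .
    qed
    then show ?case using generated_mult[OF S' Q(1) R(1)] by blast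
  qed
qed

text \<open>
  If the product stops inside a code word, then \<open>(0 | \<alpha> P) = (\<eta> | 0)\<close>, so \<open>\<eta> = 0 = \<alpha> P\<close> is reached by \<open>P\<close>
  itself, or by any matrix if \<open>P = 1\<close>.
\<close>

lemma vector_prefix_code:
  fixes As :: "'a::{semiring_0,monoid_mult} mat list"
  assumes As: "set As \<subseteq> carrier_mat n n" "length As \<ge> 3"
    and \<alpha>: "\<alpha> \<in> carrier_mat p n" and \<eta>: "\<eta> \<in> carrier_mat p n"
  shows "(\<exists>Q \<in> generated (set (prefix_code As)). hcat \<alpha> (0\<^sub>m p n) * Q = hcat \<eta> (0\<^sub>m p n)) \<longleftrightarrow>
    (\<exists>P \<in> generated (set As). \<alpha> * P = \<eta>)" (is "?L \<longleftrightarrow> ?R")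
proof
  have carrier: "\<alpha> * P \<in> carrier_mat p n" "P \<in> carrier_mat n n"
    if "P \<in> insert (1\<^sub>m n) (generated (set As))" for P
    using that \<alpha> generated_carrier[OF As(1)] by auto
  assume ?L
  then obtain Q where Q: "Q \<in> generated (set (prefix_code As))" "hcat \<alpha> (0\<^sub>m p n) * Q = hcat \<eta> (0\<^sub>m p n)" by blast
  from prefix_code_sound[OF As(1) _ \<alpha> Q(1)] As(2) consider
      P where "P \<in> generated (set As)" "hcat \<eta> (0\<^sub>m p n) = hcat (\<alpha> * P) (0\<^sub>m p n)"
    | P where "P \<in> insert (1\<^sub>m n) (generated (set As))" "hcat \<eta> (0\<^sub>m p n) = hcat (0\<^sub>m p n) (\<alpha> * P)"
    unfolding Q(2) by fastforce
  then show ?R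
  proof cases
    case (1 P)
    then show ?thesis
      using hcat_inject[OF \<eta> carrier(1) zero_carrier_mat zero_carrier_mat] by (intro bexI[of _ P]) auto
  next
    case (2 P)
    then have zero: "\<eta> = 0\<^sub>m p n" "\<alpha> * P = 0\<^sub>m p n"
      using hcat_inject[OF \<eta> zero_carrier_mat zero_carrier_mat carrier(1)] by auto
    have "hd As \<in> set As" using As(2) by (cases As) auto
    then have A: "hd As \<in> carrier_mat n n" "hd As \<in> generated (set As)" using As by (auto intro: generated.intros)
    show ?thesis
    proof (cases "P = 1\<^sub>m n")
      case True
      then have "\<alpha> * hd As = \<eta>" using zero A mult_one_mat[OF \<alpha>] by simp
      then show ?thesis using A by blast
    next
      case False
      then show ?thesis using 2(1) zero by auto
    qed
  qed
next
  assume ?R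
  then obtain P where "P \<in> generated (set As)" "\<alpha> * P = \<eta>" by blast
  with prefix_code_complete[OF As this(1)] \<alpha> show ?L by blast
qed

definition scalar_mat :: "'a \<Rightarrow> 'a mat" where
  "scalar_mat c = mat 1 1 (\<lambda>_. c)"

lemma scalar_mat_carrier [simp]: "scalar_mat c \<in> carrier_mat 1 1"
  by (simp add: scalar_mat_def)

lemma eq_scalar_mat_iff: "A \<in> carrier_mat 1 1 \<Longrightarrow> A = scalar_mat c \<longleftrightarrow> A $$ (0, 0) = c"
  by (auto simp: scalar_mat_def)

text \<open>
  The constant coordinate \<open>1\<close> is kept by all matrices. In the state after complete code words, the final
  column vector reads \<open>\<beta>\<close> and ignores it; in the other state it reads only this coordinate, with
  coefficient \<open>c\<close>. So an incomplete word yields \<open>c\<close>, which is wrong for \<open>\<gamma>\<close> unless the semiring is zero,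
  where everything is reachable.
\<close>

lemma scalar_prefix_code:
  fixes As :: "'a::{semiring_0,monoid_mult} mat list"
  assumes As: "set As \<subseteq> carrier_mat n n" "length As \<ge> 3"
    and \<alpha>: "\<alpha> \<in> carrier_mat 1 n" and \<beta>: "\<beta> \<in> carrier_mat n 1"
    and c: "c = \<gamma> \<Longrightarrow> (1::'a) = 0"
  shows "(\<exists>Q \<in> generated (set (prefix_code (map (\<lambda>A. block_diag A (1\<^sub>m 1)) As))).
      (hcat (hcat \<alpha> (1\<^sub>m 1)) (0\<^sub>m 1 (n + 1)) * Q *
        ((\<beta> @\<^sub>r 0\<^sub>m 1 1) @\<^sub>r (0\<^sub>m n 1 @\<^sub>r scalar_mat c))) $$ (0, 0) = \<gamma>) \<longleftrightarrow>
    (\<exists>P \<in> generated (set As). (\<alpha> * P * \<beta>) $$ (0, 0) = \<gamma>)" (is "?L \<longleftrightarrow> ?R")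
proof
  define f where "f A = block_diag A (1\<^sub>m 1)" for A :: "'a mat"
  have o: "(1\<^sub>m 1 :: 'a mat) \<in> carrier_mat 1 1" and z: "(0\<^sub>m 1 1 :: 'a mat) \<in> carrier_mat 1 1" by auto
  have z': "(0\<^sub>m n 1 :: 'a mat) \<in> carrier_mat n 1" by auto
  have o_o: "1\<^sub>m 1 * 1\<^sub>m 1 = (1\<^sub>m 1 :: 'a mat)" by (rule one_mult_mat) auto
  have f: "f P \<in> carrier_mat (n + 1) (n + 1)" if "P \<in> carrier_mat n n" for P
    using that o unfolding f_def by (rule block_diag_carrier)
  have fs: "set (map f As) \<subseteq> carrier_mat (n + 1) (n + 1)" using f As by auto
  have gen_f: "generated (set (map f As)) = f ` generated (set As)"
    unfolding set_map using block_diag_mult[OF _ _ o o, of _ n] o_o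
    by (intro generated_image[OF As(1)]) (simp add: f_def)
  let ?u = "hcat \<alpha> (1\<^sub>m 1)" and ?x = "\<beta> @\<^sub>r 0\<^sub>m 1 1" and ?y = "0\<^sub>m n 1 @\<^sub>r scalar_mat c"
  have u: "?u \<in> carrier_mat 1 (n + 1)" using \<alpha> o by (rule hcat_carrier)
  have x: "?x \<in> carrier_mat (n + 1) 1" using \<beta> by auto
  have y: "?y \<in> carrier_mat (n + 1) 1" by (rule carrier_append_rows) auto
  have zn: "0\<^sub>m 1 (n + 1) \<in> carrier_mat 1 (n + 1)" by auto
  have uf: "?u * f P = hcat (\<alpha> * P) (1\<^sub>m 1)" if "P \<in> carrier_mat n n" for P
    using hcat_mult_block_diag[OF \<alpha> o that o] o_o by (simp add: f_def)
  have read1: "hcat (hcat v (1\<^sub>m 1)) (0\<^sub>m 1 (n + 1)) * (?x @\<^sub>r ?y) = v * \<beta>"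
    if v: "v \<in> carrier_mat 1 n" for v
  proof -
    have "v * \<beta> \<in> carrier_mat 1 1" using v \<beta> by auto
    then show ?thesis
      using hcat_mult_append_rows[OF hcat_carrier[OF v o] zn x y] hcat_mult_append_rows[OF v o \<beta> z] y by simp
  qed
  have read2: "hcat (0\<^sub>m 1 (n + 1)) (hcat v (1\<^sub>m 1)) * (?x @\<^sub>r ?y) = scalar_mat c"
    if v: "v \<in> carrier_mat 1 n" for v
    using hcat_mult_append_rows[OF zn hcat_carrier[OF v o] x y]
      hcat_mult_append_rows[OF v o z' scalar_mat_carrier] x v
    by (simp add: one_mult_mat[OF scalar_mat_carrier])
  have len: "length (map f As) \<ge> 3" "length (map f As) \<ge> 2" using As by auto
  {
    assume ?L
    then obtain Q where Q: "Q \<in> generated (set (prefix_code (map f As)))"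
      "(hcat ?u (0\<^sub>m 1 (n + 1)) * Q * (?x @\<^sub>r ?y)) $$ (0, 0) = \<gamma>" unfolding f_def[abs_def] by blast
    from prefix_code_sound[OF fs len(2) u Q(1)] consider
        P where "P \<in> generated (set As)"
          "hcat ?u (0\<^sub>m 1 (n + 1)) * Q = hcat (hcat (\<alpha> * P) (1\<^sub>m 1)) (0\<^sub>m 1 (n + 1))"
      | v where "v \<in> carrier_mat 1 n" "hcat ?u (0\<^sub>m 1 (n + 1)) * Q = hcat (0\<^sub>m 1 (n + 1)) (hcat v (1\<^sub>m 1))"
    proof (elim disjE bexE)
      fix P assume "P \<in> generated (set (map f As))" "hcat ?u (0\<^sub>m 1 (n + 1)) * Q = hcat (?u * P) (0\<^sub>m 1 (n + 1))"
      then show ?thesis using that(1) uf generated_carrier[OF As(1)] unfolding gen_f by auto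
    next
      fix P assume "P \<in> insert (1\<^sub>m (n + 1)) (generated (set (map f As)))"
        and *: "hcat ?u (0\<^sub>m 1 (n + 1)) * Q = hcat (0\<^sub>m 1 (n + 1)) (?u * P)"
      then consider "P = 1\<^sub>m (n + 1)" | R where "R \<in> generated (set As)" "P = f R" unfolding gen_f by auto
      then show ?thesis
      proof cases
        case 1
        then show ?thesis using that(2)[OF \<alpha>] * mult_one_mat[OF u] by simp
      next
        case 2
        then show ?thesis using that(2)[of "\<alpha> * R"] * uf \<alpha> generated_carrier[OF As(1) 2(1)] by auto
      qed
    qed
    then show ?R
    proof cases
      case 1
      then show ?thesis
        using Q(2) read1[of "\<alpha> * P"] \<alpha> generated_carrier[OF As(1) 1(1)] by (intro bexI[of _ P]) auto
    next
      case 2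
      then have "c = \<gamma>" using Q(2) read2[OF 2(1)] by (simp add: scalar_mat_def)
      then have "(1::'a) = 0" by (rule c)
      moreover have "hd As \<in> set As" using As(2) by (cases As) auto
      ultimately show ?thesis using trivial_semiring by (metis generated.generator)
    qed
  }
  assume ?R
  then obtain P where P: "P \<in> generated (set As)" "(\<alpha> * P * \<beta>) $$ (0, 0) = \<gamma>" by blast
  then have "f P \<in> generated (set (map f As))" unfolding gen_f by blast
  from prefix_code_complete[OF fs len(1) this] u obtain Q where
    "Q \<in> generated (set (prefix_code (map f As)))"
    "hcat ?u (0\<^sub>m 1 (n + 1)) * Q = hcat (?u * f P) (0\<^sub>m 1 (n + 1))" by blast
  moreover have "P \<in> carrier_mat n n" using generated_carrier[OF As(1) P(1)] .
  ultimately show ?L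
    using read1[of "\<alpha> * P"] uf[of P] \<alpha> P(2) unfolding f_def[abs_def] by (intro bexI[of _ Q]) auto
qed

section \<open>From scalars to vectors\<close>

text \<open>
  Maps \<open>((x | y) | t)\<close> to \<open>((x | 0) | y \<beta> + t)\<close>: the scalar is computed from the second copy of the vector, and
  the first copy is left alone, for it has not yet been multiplied by a matrix.
\<close>

definition read_off :: "'a::{zero,one} mat \<Rightarrow> 'a mat" where
  "read_off \<beta> = four_block_mat (block_diag (1\<^sub>m (dim_row \<beta>)) (0\<^sub>m (dim_row \<beta>) (dim_row \<beta>)))
     (0\<^sub>m (dim_row \<beta>) 1 @\<^sub>r \<beta>) (0\<^sub>m 1 (dim_row \<beta> + dim_row \<beta>)) (1\<^sub>m 1)"

text \<open>
  The states that occur are \<open>((\<alpha> | 0) | 0)\<close>, \<open>((0 | \<alpha> P) | 0)\<close> and \<open>((0 | 0) | \<alpha> P \<beta>)\<close>. If one of the first two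
  equals the target \<open>((0 | 0) | \<gamma>)\<close>, then \<open>\<gamma> = 0\<close> and the vector in it is zero, so that \<open>\<gamma>\<close> is reached all
  the same.
\<close>

lemma scalar_as_vector:
  fixes As :: "'a::{semiring_0,monoid_mult} mat list"
  assumes As: "set As \<subseteq> carrier_mat n n" "As \<noteq> []"
    and \<alpha>: "\<alpha> \<in> carrier_mat 1 n" and \<beta>: "\<beta> \<in> carrier_mat n 1"
  shows "(\<exists>Q \<in> generated (set (read_off \<beta> # map (\<lambda>A. block_diag (two_copies A) (1\<^sub>m 1)) As)).
      hcat (hcat \<alpha> (0\<^sub>m 1 n)) (0\<^sub>m 1 1) * Q = hcat (hcat (0\<^sub>m 1 n) (0\<^sub>m 1 n)) (scalar_mat \<gamma>)) \<longleftrightarrow>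
    (\<exists>P \<in> generated (set As). (\<alpha> * P * \<beta>) $$ (0, 0) = \<gamma>)" (is "?L \<longleftrightarrow> ?R")
proof
  define f where "f A = block_diag (two_copies A) (1\<^sub>m 1)" for A :: "'a mat"
  have o: "(1\<^sub>m 1 :: 'a mat) \<in> carrier_mat 1 1" and z: "(0\<^sub>m p q :: 'a mat) \<in> carrier_mat p q" for p q by auto
  have o_o: "1\<^sub>m 1 * 1\<^sub>m 1 = (1\<^sub>m 1 :: 'a mat)" by (rule one_mult_mat) auto
  have f: "f P \<in> carrier_mat (n + n + 1) (n + n + 1)" if "P \<in> carrier_mat n n" for P
    using that o unfolding f_def by (intro block_diag_carrier two_copies_carrier)
  have gen_f: "generated (f ` set As) = f ` generated (set As)"
  proof (rule generated_image[OF As(1)])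
    fix P A :: "'a mat" assume "P \<in> carrier_mat n n" "A \<in> carrier_mat n n"
    then show "f (P * A) = f P * f A"
      using block_diag_mult[OF two_copies_carrier two_copies_carrier o o] o_o two_copies_mult[of P n A]
      by (simp add: f_def)
  qed
  define S where "S = insert (read_off \<beta>) (f ` set As)"
  have S_eq: "set (read_off \<beta> # map (\<lambda>A. block_diag (two_copies A) (1\<^sub>m 1)) As) = S"
    by (simp add: S_def f_def)
  have dim: "dim_row \<beta> = n" using \<beta> by auto
  have D: "block_diag (1\<^sub>m n) (0\<^sub>m n n) \<in> carrier_mat (n + n) (n + n)"
    by (rule block_diag_carrier) auto
  have b: "0\<^sub>m n 1 @\<^sub>r \<beta> \<in> carrier_mat (n + n) 1" using \<beta> by (intro carrier_append_rows) auto
  have "read_off \<beta> \<in> carrier_mat (n + n + 1) (n + n + 1)"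
    unfolding read_off_def dim using D o by (rule four_block_carrier_mat)
  then have S: "S \<subseteq> carrier_mat (n + n + 1) (n + n + 1)"
    using f As by (auto simp: S_def)
  let ?st = "\<lambda>x y t. hcat (hcat x y) t"
  have act_f: "?st x y t * f P = ?st (0\<^sub>m 1 n) (x * P + y * P) t"
    if "x \<in> carrier_mat 1 n" "y \<in> carrier_mat 1 n" "t \<in> carrier_mat 1 1" "P \<in> carrier_mat n n" for x y t P
    using hcat_mult_block_diag[OF hcat_carrier[OF that(1,2)] that(3) two_copies_carrier[OF that(4)] o]
      hcat_mult_two_copies[OF that(1,2,4)] mult_one_mat[OF that(3)] by (simp add: f_def)
  have act_r: "?st x y t * read_off \<beta> = ?st x (0\<^sub>m 1 n) (y * \<beta> + t)"
    if x: "x \<in> carrier_mat 1 n" and y: "y \<in> carrier_mat 1 n" and t: "t \<in> carrier_mat 1 1" for x y t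
  proof -
    have "y * \<beta> \<in> carrier_mat 1 1" using y \<beta> by auto
    then show ?thesis
      using hcat_mult_block[OF hcat_carrier[OF x y] t D b z o]
        hcat_mult_block_diag[OF x y one_carrier_mat z, of n]
        hcat_mult_append_rows[OF x y z \<beta>] x y t hcat_carrier[OF x z]
      by (simp add: read_off_def dim mult_one_mat[OF x] mult_one_mat[OF t])
  qed
  let ?s = "?st \<alpha> (0\<^sub>m 1 n) (0\<^sub>m 1 1)"
  have s: "?s \<in> carrier_mat 1 (n + n + 1)" using \<alpha> by (intro hcat_carrier) auto
  have states: "?s * Q = ?s \<or> (\<exists>P \<in> generated (set As). ?s * Q = ?st (0\<^sub>m 1 n) (\<alpha> * P) (0\<^sub>m 1 1)
      \<or> ?s * Q = ?st (0\<^sub>m 1 n) (0\<^sub>m 1 n) (\<alpha> * P * \<beta>))" if "Q \<in> generated S" for Q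
    using that
  proof induction
    case (generator A)
    then consider "A = read_off \<beta>" | B where "B \<in> set As" "A = f B" by (auto simp: S_def)
    then show ?case
    proof cases
      case 1
      then show ?thesis using act_r[OF \<alpha> z z] \<beta> by simp
    next
      case 2
      then have B: "B \<in> carrier_mat n n" using As by auto
      then have "\<alpha> * B \<in> carrier_mat 1 n" using \<alpha> by auto
      then have "?s * A = ?st (0\<^sub>m 1 n) (\<alpha> * B) (0\<^sub>m 1 1)"
        using act_f[OF \<alpha> z z B] B 2 by simp
      then show ?thesis using 2 by (auto intro: generated.intros)
    qed
  next
    case (snoc Q A)
    note assoc = mult_inner_assoc[OF s S snoc.hyps]
    have P: "P \<in> carrier_mat n n" "\<alpha> * P \<in> carrier_mat 1 n" "\<alpha> * P * \<beta> \<in> carrier_mat 1 1"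
      if "P \<in> generated (set As)" for P
      using generated_carrier[OF As(1) that] \<alpha> \<beta> by auto
    from snoc.hyps(2) consider "A = read_off \<beta>" | B where "B \<in> set As" "A = f B" by (auto simp: S_def)
    then show ?case
    proof cases
      case 1
      have "?st \<alpha> (0\<^sub>m 1 n) (0\<^sub>m 1 1) * A = ?s" using 1 act_r[OF \<alpha> z z] \<beta> by simp
      moreover have "?st (0\<^sub>m 1 n) (\<alpha> * P) (0\<^sub>m 1 1) * A = ?st (0\<^sub>m 1 n) (0\<^sub>m 1 n) (\<alpha> * P * \<beta>)"
        "?st (0\<^sub>m 1 n) (0\<^sub>m 1 n) (\<alpha> * P * \<beta>) * A = ?st (0\<^sub>m 1 n) (0\<^sub>m 1 n) (\<alpha> * P * \<beta>)"
        if "P \<in> generated (set As)" for P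
        using 1 act_r[OF z P(2)[OF that] z] act_r[OF z z P(3)[OF that]] P[OF that] \<beta> by simp_all
      ultimately show ?thesis
        unfolding assoc using snoc.IH by fastforce
    next
      case 2
      then have B: "B \<in> carrier_mat n n" using As by auto
      have \<alpha>B: "\<alpha> * B \<in> carrier_mat 1 n" using \<alpha> B by auto
      have "?st \<alpha> (0\<^sub>m 1 n) (0\<^sub>m 1 1) * A = ?st (0\<^sub>m 1 n) (\<alpha> * B) (0\<^sub>m 1 1)"
        using 2 act_f[OF \<alpha> z z B] B \<alpha>B by simp
      moreover have "?st (0\<^sub>m 1 n) (\<alpha> * P) (0\<^sub>m 1 1) * A = ?st (0\<^sub>m 1 n) (\<alpha> * (P * B)) (0\<^sub>m 1 1)"
        "?st (0\<^sub>m 1 n) (0\<^sub>m 1 n) (\<alpha> * P * \<beta>) * A = ?st (0\<^sub>m 1 n) (0\<^sub>m 1 n) (\<alpha> * P * \<beta>)"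
        if "P \<in> generated (set As)" for P
      proof -
        have "\<alpha> * P * B \<in> carrier_mat 1 n" using P[OF that] B by auto
        moreover have "\<alpha> * P * B = \<alpha> * (P * B)" using \<alpha> P[OF that] B by (intro assoc_mult_mat) auto
        ultimately show "?st (0\<^sub>m 1 n) (\<alpha> * P) (0\<^sub>m 1 1) * A = ?st (0\<^sub>m 1 n) (\<alpha> * (P * B)) (0\<^sub>m 1 1)"
          using 2 act_f[OF z P(2)[OF that] z B] B by simp
        show "?st (0\<^sub>m 1 n) (0\<^sub>m 1 n) (\<alpha> * P * \<beta>) * A = ?st (0\<^sub>m 1 n) (0\<^sub>m 1 n) (\<alpha> * P * \<beta>)"
          using 2 act_f[OF z z P(3)[OF that] B] B by simp
      qed
      ultimately show ?thesis
        unfolding assoc using snoc.IH 2(1) generated.snoc[OF _ 2(1)] generated.generator[OF 2(1)]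
        by metis
    qed
  qed
  have zz: "hcat (0\<^sub>m 1 n) (0\<^sub>m 1 n :: 'a mat) \<in> carrier_mat 1 (n + n)" by (intro hcat_carrier z)
  {
    assume ?L
    then obtain Q where Q: "Q \<in> generated S" "?s * Q = ?st (0\<^sub>m 1 n) (0\<^sub>m 1 n) (scalar_mat \<gamma>)"
      unfolding S_eq by blast
    have zero: ?R if "P \<in> generated (set As)" "\<alpha> * P = 0\<^sub>m 1 n" "scalar_mat \<gamma> = 0\<^sub>m 1 1" for P
    proof -
      have "\<alpha> * P * \<beta> = scalar_mat \<gamma>" using that \<beta> by simp
      then show ?R using that(1) by (auto simp: scalar_mat_def intro!: bexI[of _ P])
    qed
    have A: "hd As \<in> set As" "hd As \<in> carrier_mat n n" using As by (cases As; auto)+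
    from states[OF Q(1)] consider "?s * Q = ?s"
      | P where "P \<in> generated (set As)" "?s * Q = ?st (0\<^sub>m 1 n) (\<alpha> * P) (0\<^sub>m 1 1)"
      | P where "P \<in> generated (set As)" "?s * Q = ?st (0\<^sub>m 1 n) (0\<^sub>m 1 n) (\<alpha> * P * \<beta>)" by blast
    then show ?R
    proof cases
      case 1
      then have "?s = ?st (0\<^sub>m 1 n) (0\<^sub>m 1 n) (scalar_mat \<gamma>)" using Q(2) by simp
      then have "\<alpha> = 0\<^sub>m 1 n" "scalar_mat \<gamma> = 0\<^sub>m 1 1"
        using hcat_inject[OF hcat_carrier[OF \<alpha> z] zz z scalar_mat_carrier]
          hcat_inject[OF \<alpha> z z z] by auto
      then show ?thesis using zero[OF generated.generator[OF A(1)]] A by simp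
    next
      case 2
      have P: "\<alpha> * P \<in> carrier_mat 1 n" using \<alpha> generated_carrier[OF As(1) 2(1)] by auto
      have "?st (0\<^sub>m 1 n) (\<alpha> * P) (0\<^sub>m 1 1) = ?st (0\<^sub>m 1 n) (0\<^sub>m 1 n) (scalar_mat \<gamma>)"
        using 2(2) Q(2) by simp
      then show ?thesis
        using hcat_inject[OF hcat_carrier[OF z P] zz z scalar_mat_carrier]
          hcat_inject[OF z z P z] by (intro zero[OF 2(1)]) auto
    next
      case 3
      have P: "\<alpha> * P * \<beta> \<in> carrier_mat 1 1" using \<alpha> \<beta> generated_carrier[OF As(1) 3(1)] by auto
      have "?st (0\<^sub>m 1 n) (0\<^sub>m 1 n) (\<alpha> * P * \<beta>) = ?st (0\<^sub>m 1 n) (0\<^sub>m 1 n) (scalar_mat \<gamma>)"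
        using 3(2) Q(2) by simp
      then have "\<alpha> * P * \<beta> = scalar_mat \<gamma>"
        using hcat_inject[OF zz zz P scalar_mat_carrier] by blast
      then show ?thesis using 3(1) eq_scalar_mat_iff[OF P] by blast
    qed
  }
  assume ?R
  then obtain P where P: "P \<in> generated (set As)" "(\<alpha> * P * \<beta>) $$ (0, 0) = \<gamma>" by blast
  have c: "P \<in> carrier_mat n n" "\<alpha> * P \<in> carrier_mat 1 n" "\<alpha> * P * \<beta> \<in> carrier_mat 1 1"
    using generated_carrier[OF As(1) P(1)] \<alpha> \<beta> by auto
  have "f P \<in> generated S"
    using P(1) gen_f by (intro generated_mono[of "f ` set As" S]) (auto simp: S_def)
  have "read_off \<beta> \<in> S" by (simp add: S_def)
  have eq: "\<alpha> * P * \<beta> = scalar_mat \<gamma>" using P(2) eq_scalar_mat_iff[OF c(3)] by blast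
  have "f P * read_off \<beta> \<in> generated S"
    using \<open>f P \<in> generated S\<close> \<open>read_off \<beta> \<in> S\<close> by (rule generated.snoc)
  moreover have "?s * (f P * read_off \<beta>) = ?st (0\<^sub>m 1 n) (0\<^sub>m 1 n) (scalar_mat \<gamma>)"
    unfolding mult_inner_assoc[OF s S \<open>f P \<in> generated S\<close> \<open>read_off \<beta> \<in> S\<close>]
    using act_f[OF \<alpha> z z c(1)] act_r[OF z c(2) z] c eq by simp
  ultimately show ?L unfolding S_eq by blast
qed

section \<open>From matrices to vectors\<close>

text \<open>
  The recursion starts with the empty matrix, so that a loop over the rows of \<open>M\<close> computes both the block
  diagonal and the row vector.
\<close>

primrec diag_copies :: "nat \<Rightarrow> 'a::zero mat \<Rightarrow> 'a mat" where
  "diag_copies 0 A = 0\<^sub>m 0 0"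
| "diag_copies (Suc k) A = block_diag (diag_copies k A) A"

primrec join_rows :: "nat \<Rightarrow> 'a::zero mat \<Rightarrow> 'a mat" where
  "join_rows 0 M = 0\<^sub>m 1 0"
| "join_rows (Suc k) M = hcat (join_rows k M) (mat 1 (dim_col M) (\<lambda>(_, j). M $$ (k, j)))"

lemma diag_copies_carrier: "A \<in> carrier_mat n n \<Longrightarrow> diag_copies k A \<in> carrier_mat (k * n) (k * n)"
  by (induction k) (auto simp: add.commute[of n] intro!: block_diag_carrier)

lemma join_rows_carrier: "M \<in> carrier_mat m n \<Longrightarrow> join_rows k M \<in> carrier_mat 1 (k * n)"
  by (induction k) (auto simp: add.commute[of n] intro!: hcat_carrier)

lemma diag_copies_mult:
  fixes A :: "'a::semiring_0 mat"
  assumes "P \<in> carrier_mat n n" "A \<in> carrier_mat n n"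
  shows "diag_copies k (P * A) = diag_copies k P * diag_copies k A"
proof (induction k)
  case (Suc k)
  then show ?case
    using block_diag_mult[OF diag_copies_carrier[OF assms(1)] diag_copies_carrier[OF assms(2)] assms] by simp
qed auto

lemma join_rows_mult_diag_copies:
  fixes A :: "'a::semiring_0 mat"
  assumes M: "M \<in> carrier_mat m n" and A: "A \<in> carrier_mat n n" and k: "k \<le> m"
  shows "join_rows k M * diag_copies k A = join_rows k (M * A)"
  using k
proof (induction k)
  case (Suc k)
  have row: "mat 1 n (\<lambda>(_, j). M $$ (k, j)) * A = mat 1 n (\<lambda>(_, j). (M * A) $$ (k, j))"
    using M A Suc.prems by (intro eq_matI) (auto simp: scalar_prod_def)
  show ?case
    using hcat_mult_block_diag[OF join_rows_carrier[OF M] _ diag_copies_carrier[OF A] A,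
        of "mat 1 n (\<lambda>(_, j). M $$ (k, j))"] Suc row M A by simp
qed auto

lemma join_rows_inject:
  assumes M: "M \<in> carrier_mat m n" and N: "N \<in> carrier_mat m n" and eq: "join_rows m M = join_rows m N"
  shows "M = N"
proof -
  have "M $$ (i, j) = N $$ (i, j)" if "join_rows k M = join_rows k N" "i < k" "j < n" for i j k
    using that(1,2)
  proof (induction k)
    case (Suc k)
    have "join_rows k M = join_rows k N"
      and row: "mat 1 n (\<lambda>(_, j). M $$ (k, j)) = mat 1 n (\<lambda>(_, j). N $$ (k, j))"
      using Suc.prems(1) M N
        hcat_inject[OF join_rows_carrier[OF M] join_rows_carrier[OF N] mat_carrier mat_carrier, of k] by auto
    moreover have "M $$ (k, j) = N $$ (k, j)"
      using arg_cong[OF row, of "\<lambda>A. A $$ (0, j)"] that(3) by simp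
    ultimately show ?case
      using Suc by (cases "i = k") auto
  qed auto
  from this[OF eq] show ?thesis using M N by (intro eq_matI) auto
qed

lemma matrix_as_vector:
  fixes As :: "'a::{semiring_0,monoid_mult} mat list"
  assumes As: "set As \<subseteq> carrier_mat n n" and M: "M \<in> carrier_mat n n"
  shows "(\<exists>Q \<in> generated (set (map (diag_copies n) As)). join_rows n (1\<^sub>m n) * Q = join_rows n M) \<longleftrightarrow>
    M \<in> generated (set As)"
proof -
  have "join_rows n (1\<^sub>m n) * diag_copies n P = join_rows n M \<longleftrightarrow> P = M" if "P \<in> generated (set As)" for P
  proof -
    have P: "P \<in> carrier_mat n n" using As that by (rule generated_carrier)
    show ?thesis
      using join_rows_mult_diag_copies[OF one_carrier_mat P le_refl] one_mult_mat[OF P]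
        join_rows_inject[OF P M] by auto
  qed
  moreover have "generated (set (map (diag_copies n) As)) = diag_copies n ` generated (set As)"
    unfolding set_map using As by (rule generated_image) (rule diag_copies_mult)
  ultimately show ?thesis by auto
qed

section \<open>From vectors to matrices\<close>

text \<open>
  The entry \<open>1\<close> in the corner makes these matrices absorb the other letters on their left, and
  distinguishes them from zero.
\<close>

definition top_row :: "'a::{zero,one} mat \<Rightarrow> 'a mat" where
  "top_row v = four_block_mat (1\<^sub>m 1) v (0\<^sub>m (dim_col v) 1) (0\<^sub>m (dim_col v) (dim_col v))"

lemma top_row_carrier [simp]: "v \<in> carrier_mat 1 n \<Longrightarrow> top_row v \<in> carrier_mat (1 + n) (1 + n)"
  by (auto simp: top_row_def)

lemma top_row_inject:
  assumes "u \<in> carrier_mat 1 n" "v \<in> carrier_mat 1 n"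
  shows "top_row u = top_row v \<longleftrightarrow> u = v"
proof
  assume eq: "top_row u = top_row v"
  have "u $$ (0, j) = v $$ (0, j)" if "j < n" for j
    using arg_cong[OF eq, of "\<lambda>A. A $$ (0, 1 + j)"] that assms by (simp add: top_row_def)
  then show "u = v" using assms by (auto intro!: eq_matI)
qed simp

lemma top_row_eq_block_diag:
  assumes "top_row v = block_diag (1\<^sub>m 1) D" "v \<in> carrier_mat 1 n" "D \<in> carrier_mat n n"
  shows "v = 0\<^sub>m 1 n" and "D = 0\<^sub>m n n"
proof -
  have "v $$ (0, j) = 0" if "j < n" for j
    using arg_cong[OF assms(1), of "\<lambda>A. A $$ (0, 1 + j)"] that assms(2,3)
    by (simp add: top_row_def block_diag_def)
  then show "v = 0\<^sub>m 1 n" using assms(2) by (auto intro!: eq_matI)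
  have "D $$ (i, j) = 0" if "i < n" "j < n" for i j
    using arg_cong[OF assms(1), of "\<lambda>A. A $$ (1 + i, 1 + j)"] that assms(2,3)
    by (simp add: top_row_def block_diag_def)
  then show "D = 0\<^sub>m n n" using assms(3) by (auto intro!: eq_matI)
qed

lemma top_row_mult:
  fixes u v :: "'a::{semiring_0,monoid_mult} mat"
  assumes u: "u \<in> carrier_mat 1 n" and v: "v \<in> carrier_mat 1 n" and D: "D \<in> carrier_mat n n"
  shows "top_row u * top_row v = top_row v"
    and "top_row u * block_diag (1\<^sub>m 1) D = top_row (u * D)"
    and "block_diag (1\<^sub>m 1) D * top_row v = top_row v"
proof -
  have o: "(1\<^sub>m 1 :: 'a mat) \<in> carrier_mat 1 1" and z: "(0\<^sub>m p q :: 'a mat) \<in> carrier_mat p q" for p q by auto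
  have o_o: "1\<^sub>m 1 * 1\<^sub>m 1 = (1\<^sub>m 1 :: 'a mat)" by (rule one_mult_mat) auto
  have "u * D \<in> carrier_mat 1 n" using u D by auto
  then show "top_row u * top_row v = top_row v"
    and "top_row u * block_diag (1\<^sub>m 1) D = top_row (u * D)"
    and "block_diag (1\<^sub>m 1) D * top_row v = top_row v"
    using mult_four_block_mat[OF o u z z o v z z] mult_four_block_mat[OF o u z z o z z D]
      mult_four_block_mat[OF o z z D o v z z] u v D o_o one_mult_mat[OF v]
    by (simp_all add: top_row_def block_diag_def)
qed

text \<open>
  Everything before the last reset is absorbed by it.
\<close>

lemma generated_with_reset:
  fixes As :: "'a::{semiring_0,monoid_mult} mat list"
  assumes As: "set As \<subseteq> carrier_mat n n" and \<alpha>: "\<alpha> \<in> carrier_mat 1 n"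
    and Q: "Q \<in> generated (insert (top_row (hcat \<alpha> (0\<^sub>m 1 n)))
      ((\<lambda>A. block_diag (1\<^sub>m 1) (two_copies A)) ` set As))"
  shows "Q = top_row (hcat \<alpha> (0\<^sub>m 1 n)) \<or> (\<exists>P \<in> generated (set As).
    Q = block_diag (1\<^sub>m 1) (two_copies P) \<or> Q = top_row (hcat (0\<^sub>m 1 n) (\<alpha> * P)))"
  using Q
proof induction
  case (generator A)
  then show ?case by (auto intro: generated.intros)
next
  case (snoc Q A)
  let ?f = "\<lambda>P. block_diag (1\<^sub>m 1) (two_copies P)" and ?s = "hcat \<alpha> (0\<^sub>m 1 n)"
  have s: "?s \<in> carrier_mat 1 (n + n)" using \<alpha> by simp
  have P: "P \<in> carrier_mat n n" "two_copies P \<in> carrier_mat (n + n) (n + n)"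
    "\<alpha> * P \<in> carrier_mat 1 n" "hcat (0\<^sub>m 1 n) (\<alpha> * P) \<in> carrier_mat 1 (n + n)"
    if "P \<in> generated (set As)" for P
    using generated_carrier[OF As that] \<alpha> by auto
  from snoc.hyps(2) consider "A = top_row ?s" | B where "B \<in> set As" "A = ?f B" by auto
  then show ?case
  proof cases
    case 1
    have "Q * A = top_row ?s"
      using snoc.IH top_row_mult(1)[OF s s P(2)] top_row_mult(3)[OF s s P(2)]
        top_row_mult(1)[OF P(4) s P(2)] unfolding 1
      by (metis s top_row_mult(1) zero_carrier_mat)
    then show ?thesis by simp
  next
    case 2
    then have B: "B \<in> generated (set As)" by (auto intro: generated.intros)
    have "top_row ?s * A = top_row (hcat (0\<^sub>m 1 n) (\<alpha> * B))"
      using top_row_mult(2)[OF s s P(2)[OF B]] hcat_mult_two_copies[OF \<alpha> zero_carrier_mat P(1)[OF B]]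
        P[OF B] by (simp add: 2)
    moreover have "top_row (hcat (0\<^sub>m 1 n) (\<alpha> * P)) * A = top_row (hcat (0\<^sub>m 1 n) (\<alpha> * (P * B)))"
      "?f P * A = ?f (P * B)" if "P \<in> generated (set As)" for P
    proof -
      have "\<alpha> * P * B \<in> carrier_mat 1 n" using P(3)[OF that] P(1)[OF B] by auto
      moreover have "\<alpha> * P * B = \<alpha> * (P * B)" using \<alpha> P(1)[OF that] P(1)[OF B] by (intro assoc_mult_mat)
      ultimately show "top_row (hcat (0\<^sub>m 1 n) (\<alpha> * P)) * A = top_row (hcat (0\<^sub>m 1 n) (\<alpha> * (P * B)))"
        using top_row_mult(2)[OF P(4)[OF that] s P(2)[OF B]]
          hcat_mult_two_copies[OF zero_carrier_mat P(3)[OF that] P(1)[OF B]] P(1)[OF B] by (simp add: 2)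
      show "?f P * A = ?f (P * B)"
        unfolding 2 using block_diag_mult[OF one_carrier_mat one_carrier_mat P(2)[OF that] P(2)[OF B]]
          two_copies_mult[OF P(1)[OF that] P(1)[OF B]] one_mult_mat[OF one_carrier_mat] by metis
    qed
    ultimately show ?thesis
      using snoc.IH B generated.snoc[OF _ 2(1)] by metis
  qed
qed

text \<open>
  The target has to prescribe the rows of both states of the prefix code. After the reset they agree, which
  is why \<open>T\<close> occurs twice. For the converse the rows of the first state suffice, extracted by the factor
  \<open>(1 | 0)\<close>: they show that \<open>T\<close> is a product of the uncoded matrices. Such a product without reset, or
  with a final reset, is \<open>T\<close> only if \<open>\<eta> = 0\<close> and some product of \<open>As\<close> maps \<open>\<alpha>\<close> to zero. A product ending
  inside a code word would give \<open>T = 0\<close>, which means \<open>1 = 0\<close>.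
\<close>

lemma vector_as_matrix:
  fixes As :: "'a::{semiring_0,monoid_mult} mat list"
  assumes As: "set As \<subseteq> carrier_mat n n" "length As \<ge> 2"
    and \<alpha>: "\<alpha> \<in> carrier_mat 1 n" and \<eta>: "\<eta> \<in> carrier_mat 1 n"
  defines "T \<equiv> top_row (hcat (0\<^sub>m 1 n) \<eta>)" and "N \<equiv> 1 + (n + n)"
    and "Xs \<equiv> top_row (hcat \<alpha> (0\<^sub>m 1 n)) # map (\<lambda>A. block_diag (1\<^sub>m 1) (two_copies A)) As"
  shows "four_block_mat T (0\<^sub>m N N) T (0\<^sub>m N N) \<in> generated (set (prefix_code Xs)) \<longleftrightarrow>
    (\<exists>P \<in> generated (set As). \<alpha> * P = \<eta>)" (is "?T \<in> _ \<longleftrightarrow> ?R")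
proof
  let ?s = "hcat \<alpha> (0\<^sub>m 1 n)" and ?t = "hcat (0\<^sub>m 1 n) \<eta>"
  let ?f = "\<lambda>A. block_diag (1\<^sub>m 1) (two_copies A)"
  have s: "?s \<in> carrier_mat 1 (n + n)" "?t \<in> carrier_mat 1 (n + n)" using \<alpha> \<eta> by auto
  have T: "T \<in> carrier_mat N N" unfolding T_def N_def using s by simp
  have f: "?f P \<in> carrier_mat N N" if "P \<in> carrier_mat n n" for P
    unfolding N_def using that by (intro block_diag_carrier two_copies_carrier) auto
  have set_Xs: "set Xs = insert (top_row ?s) (?f ` set As)" by (simp add: Xs_def)
  have len: "length Xs \<ge> 3" "length Xs \<ge> 2" using As by (auto simp: Xs_def)
  have Xs: "set Xs \<subseteq> carrier_mat N N"
    unfolding set_Xs using f As(1) top_row_carrier[OF s(1)] by (auto simp: N_def)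
  have zT: "0\<^sub>m N N \<in> carrier_mat N N" by simp
  have T_eq: "?T = hcat (T @\<^sub>r T) (0\<^sub>m (N + N) N)"
    using T by (intro eq_matI) (auto simp: hcat_def append_rows_def)
  have A: "hd As \<in> generated (set As)" "hd As \<in> carrier_mat n n"
    using As by (cases As; auto intro: generated.intros)+
  {
    assume Q: "?T \<in> generated (set (prefix_code Xs))"
    have first: "hcat (1\<^sub>m N) (0\<^sub>m N N) * ?T = hcat T (0\<^sub>m N N)"
      using hcat_mult_block[OF one_carrier_mat zT T zT T zT] T one_mult_mat[OF T]
        right_mult_zero_mat[OF one_carrier_mat] by simp
    have one: "1\<^sub>m N * P = P" if "P \<in> insert (1\<^sub>m N) (generated (set Xs))" for P :: "'a mat"
      using that generated_carrier[OF Xs] one_mult_mat[of P N N] by auto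
    from prefix_code_sound[OF Xs len(2) one_carrier_mat Q] consider
        "T \<in> generated (set Xs)" | P where "P \<in> carrier_mat N N" "hcat T (0\<^sub>m N N) = hcat (0\<^sub>m N N) P"
    proof (elim disjE bexE)
      fix P assume "P \<in> generated (set Xs)" "hcat (1\<^sub>m N) (0\<^sub>m N N) * ?T = hcat (1\<^sub>m N * P) (0\<^sub>m N N)"
      then have "T \<in> generated (set Xs)"
        using one hcat_inject[OF T generated_carrier[OF Xs] zT zT] unfolding first by auto
      then show ?thesis by (rule that(1))
    next
      fix P assume P: "P \<in> insert (1\<^sub>m N) (generated (set Xs))"
        "hcat (1\<^sub>m N) (0\<^sub>m N N) * ?T = hcat (0\<^sub>m N N) (1\<^sub>m N * P)"
      moreover have "P \<in> carrier_mat N N" using P(1) generated_carrier[OF Xs] by auto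
      ultimately show ?thesis using that(2)[of P] one unfolding first by auto
    qed
    then show ?R
    proof cases
      case 1
      from generated_with_reset[OF As(1) \<alpha>] 1 consider "T = top_row ?s"
        | P where "P \<in> generated (set As)" "T = ?f P"
        | P where "P \<in> generated (set As)" "T = top_row (hcat (0\<^sub>m 1 n) (\<alpha> * P))"
        unfolding set_Xs by blast
      then show ?thesis
      proof cases
        case 1
        then have "\<eta> = 0\<^sub>m 1 n" "\<alpha> = 0\<^sub>m 1 n"
          using top_row_inject[OF s(2,1)] hcat_inject[OF zero_carrier_mat \<alpha> \<eta> zero_carrier_mat]
          unfolding T_def by auto
        then show ?thesis using A by (intro bexI[of _ "hd As"]) auto
      next
        case 2
        then have P: "P \<in> carrier_mat n n" "two_copies P \<in> carrier_mat (n + n) (n + n)"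
          using generated_carrier[OF As(1) 2(1)] by auto
        have "?t = 0\<^sub>m 1 (n + n)" "two_copies P = 0\<^sub>m (n + n) (n + n)"
          using top_row_eq_block_diag[OF _ s(2) P(2)] 2(2) by (simp_all add: T_def)
        then have "?t $$ (0, n + j) = 0" "two_copies P $$ (i, n + j) = 0" if "i < n" "j < n" for i j
          using that by auto
        then have "\<eta> = 0\<^sub>m 1 n" "P = 0\<^sub>m n n"
          using P(1) \<eta> by (auto intro!: eq_matI simp: hcat_def two_copies_def)
        then show ?thesis using 2(1) \<alpha> by (intro bexI[of _ P]) auto
      next
        case 3
        then have "\<alpha> * P \<in> carrier_mat 1 n" using \<alpha> generated_carrier[OF As(1)] by auto
        then have "\<alpha> * P = \<eta>"
          using 3(2) top_row_inject[OF s(2) hcat_carrier[OF zero_carrier_mat]]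
            hcat_inject[OF zero_carrier_mat zero_carrier_mat \<eta>] unfolding T_def by metis
        then show ?thesis using 3(1) by blast
      qed
    next
      case 2
      then have "T = 0\<^sub>m N N" using hcat_inject[OF T zT zT] by blast
      then have "T $$ (0, 0) = 0" by (simp add: N_def)
      then have "(1::'a) = 0" by (simp add: T_def top_row_def)
      then have "\<alpha> * hd As = \<eta>" using trivial_semiring \<alpha> \<eta> A(2) by (intro eq_matI) auto
      then show ?thesis using A(1) by blast
    qed
  }
  assume ?R
  then obtain P where P: "P \<in> generated (set As)" "\<alpha> * P = \<eta>" by blast
  have Pc: "P \<in> carrier_mat n n" "two_copies P \<in> carrier_mat (n + n) (n + n)"
    using generated_carrier[OF As(1) P(1)] by auto
  have gen_f: "generated (?f ` set As) = ?f ` generated (set As)"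
  proof (rule generated_image[OF As(1)])
    fix P A :: "'a mat" assume "P \<in> carrier_mat n n" "A \<in> carrier_mat n n"
    then show "?f (P * A) = ?f P * ?f A"
      using block_diag_mult[OF one_carrier_mat one_carrier_mat two_copies_carrier two_copies_carrier]
        two_copies_mult one_mult_mat[OF one_carrier_mat] by metis
  qed
  have "?f P \<in> generated (set Xs)"
    using P(1) gen_f by (intro generated_mono[of "?f ` set As" "set Xs"]) (auto simp: set_Xs)
  then have "top_row ?s * ?f P \<in> generated (set Xs)"
    by (intro generated_mult[OF Xs]) (auto simp: set_Xs intro: generated.intros)
  moreover have "top_row ?s * ?f P = T"
    using top_row_mult(2)[OF s(1,1) Pc(2)] hcat_mult_two_copies[OF \<alpha> zero_carrier_mat Pc(1)] P(2) \<eta> Pc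
    by (simp add: T_def)
  ultimately have "T \<in> generated (set Xs)" by simp
  from prefix_code_complete[OF Xs len(1) this] obtain Q where Q: "Q \<in> generated (set (prefix_code Xs))"
    "\<And>u p. u \<in> carrier_mat p N \<Longrightarrow> hcat u (0\<^sub>m p N) * Q = hcat (u * T) (0\<^sub>m p N)" by blast
  obtain A B Bs where As_eq: "As = A # B # Bs"
    using As(2) by (cases As rule: prefix_code.cases) auto
  \<comment> \<open>The letter \<open>b = code_tail (?f A) (?f B)\<close> is put in front of the code word of the reset: it brings
    the rows of both states to the first state, with contents \<open>?f B\<close> and \<open>?f A\<close>, which the reset absorbs.\<close>
  let ?u = "?f B @\<^sub>r ?f A"
  have AB: "two_copies A \<in> carrier_mat (n + n) (n + n)" "two_copies B \<in> carrier_mat (n + n) (n + n)"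
    "?f A \<in> carrier_mat N N" "?f B \<in> carrier_mat N N"
    using As(1) f by (auto simp: As_eq)
  have tail: "code_tail (?f A) (?f B) = hcat ?u (0\<^sub>m (N + N) N)"
    using AB by (intro eq_matI) (auto simp: code_tail_def hcat_def append_rows_def)
  have u: "?u \<in> carrier_mat (N + N) N" using AB(4,3) by (rule carrier_append_rows)
  have "?u * T = T @\<^sub>r T"
    using append_rows_mult[OF AB(4,3) T] top_row_mult(3)[OF s(1,2)] AB by (simp add: T_def)
  then have "code_tail (?f A) (?f B) * Q = ?T" unfolding T_eq tail using Q(2)[OF u] by simp
  moreover have "code_tail (?f A) (?f B) \<in> generated (set (prefix_code Xs))"
    by (auto simp: Xs_def As_eq intro: generated.intros)
  ultimately show "?T \<in> generated (set (prefix_code Xs))"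
    using generated_mult[OF prefix_code_carrier[OF Xs len(2)] _ Q(1)] by metis
qed

section \<open>Computing codes of block matrices\<close>

definition vstack :: "tree \<Rightarrow> tree \<Rightarrow> tree" where
  "vstack s t = list_code (elems s @ elems t)"

text \<open>
  A recursion on the first list of rows that takes apart the second one along the way is computed by a
  single loop.
\<close>

primrec append_rowwise :: "tree list \<Rightarrow> tree \<Rightarrow> tree" where
  "append_rowwise [] t = Leaf"
| "append_rowwise (r # rs) t = Node (vstack r (left t)) (append_rowwise rs (right t))"

definition hstack :: "tree \<Rightarrow> tree \<Rightarrow> tree" where
  "hstack s t = append_rowwise (elems s) t"

lemma computable_vstack: "computable f \<Longrightarrow> computable g \<Longrightarrow> computable (\<lambda>x. vstack (f x) (g x))"
  unfolding vstack_def by (rule computable_append)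

lemma computable_hstack:
  assumes "computable f" "computable g"
  shows "computable (\<lambda>x. hstack (f x) (g x))"
proof -
  let ?step = "\<lambda>s r. Node (Node (vstack r (left (right s))) (left s)) (right (right s))"
  have "list_code (rev (elems (left (foldl ?step (Node a t) rs)))) =
    list_code (rev (elems a) @ elems (append_rowwise rs t))" for a t rs
    by (induction rs arbitrary: a t) auto
  from this[of Leaf] have eq: "hstack s t = list_code (rev (elems (left (foldl ?step (Node Leaf t) (elems s)))))"
    for s t by (simp add: hstack_def)
  show ?thesis
    unfolding eq by (intro computable_rev computable_left computable_foldl computable_basic computable_vstack assms)
qed

definition block_tree :: "tree \<Rightarrow> tree \<Rightarrow> tree \<Rightarrow> tree \<Rightarrow> tree" where
  "block_tree a b c d = vstack (hstack a b) (hstack c d)"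

lemma computable_block:
  "computable a \<Longrightarrow> computable b \<Longrightarrow> computable c \<Longrightarrow> computable d \<Longrightarrow>
    computable (\<lambda>x. block_tree (a x) (b x) (c x) (d x))"
  unfolding block_tree_def by (intro computable_vstack computable_hstack)

definition singleton_tree :: "tree \<Rightarrow> tree" where
  "singleton_tree t = list_code [list_code [t]]"

lemma computable_singleton_tree: "computable f \<Longrightarrow> computable (\<lambda>x. singleton_tree (f x))"
  unfolding singleton_tree_def list_code.simps by (intro computable_basic)

text \<open>
  Since all trees are list codes, the witness in \<open>represents_mat\<close> can be read off the tree.
\<close>

lemma represents_mat_iff:
  "represents_mat \<rho> t A \<longleftrightarrow> length (elems t) = dim_row A \<and>
    (\<forall>i < dim_row A. length (elems (elems t ! i)) = dim_col A \<and>
      (\<forall>j < dim_col A. \<rho> (elems (elems t ! i) ! j) = Some (A $$ (i, j))))"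
proof -
  have "represents_mat \<rho> t A \<longleftrightarrow> map (map \<rho>) (map elems (elems t)) = map (map Some) (mat_to_list A)"
  proof
    assume "map (map \<rho>) (map elems (elems t)) = map (map Some) (mat_to_list A)"
    then show "represents_mat \<rho> t A"
      unfolding represents_mat_def by (intro exI[of _ "map elems (elems t)"]) (simp add: o_def)
  qed (auto simp: represents_mat_def o_def)
  also have "\<dots> \<longleftrightarrow> length (elems t) = dim_row A \<and>
    (\<forall>i < dim_row A. length (elems (elems t ! i)) = dim_col A \<and>
      (\<forall>j < dim_col A. \<rho> (elems (elems t ! i) ! j) = Some (A $$ (i, j))))"
    by (auto simp: list_eq_iff_nth_eq mat_to_list_def)
  finally show ?thesis .
qed

lemma represents_mat_dim_row: "represents_mat \<rho> t A \<Longrightarrow> length (elems t) = dim_row A"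
  by (simp add: represents_mat_iff)

lemma represents_mat_dim_col:
  "represents_mat \<rho> t A \<Longrightarrow> dim_row A \<ge> 1 \<Longrightarrow> length (elems (left t)) = dim_col A"
  unfolding represents_mat_iff by (cases t) (auto dest!: spec[of _ 0])

lemma represents_vstack:
  assumes "represents_mat \<rho> s A" "represents_mat \<rho> t B" "dim_col A = dim_col B"
  shows "represents_mat \<rho> (vstack s t) (A @\<^sub>r B)"
  using assms by (auto simp: represents_mat_iff vstack_def append_rows_def nth_append)

lemma elems_hstack:
  "length (elems s) = length (elems t) \<Longrightarrow> elems (hstack s t) = map2 vstack (elems s) (elems t)"
proof -
  have "length rs = length (elems t) \<Longrightarrow> elems (append_rowwise rs t) = map2 vstack rs (elems t)" for rs
  proof (induction rs arbitrary: t)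
    case (Cons r rs)
    then show ?case by (cases t) auto
  qed auto
  then show "length (elems s) = length (elems t) \<Longrightarrow> elems (hstack s t) = map2 vstack (elems s) (elems t)"
    by (simp add: hstack_def)
qed

lemma represents_hstack:
  assumes "represents_mat \<rho> s A" "represents_mat \<rho> t B" "dim_row A = dim_row B"
  shows "represents_mat \<rho> (hstack s t) (hcat A B)"
  using assms by (auto simp: represents_mat_iff elems_hstack vstack_def hcat_def nth_append)

lemma represents_block:
  fixes \<rho> :: "tree \<Rightarrow> 's::zero option"
  assumes "represents_mat \<rho> a A" "represents_mat \<rho> b B" "represents_mat \<rho> c C" "represents_mat \<rho> d D"
    and "A \<in> carrier_mat n n'" "B \<in> carrier_mat n m'" "C \<in> carrier_mat m n'" "D \<in> carrier_mat m m'"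
  shows "represents_mat \<rho> (block_tree a b c d) (four_block_mat A B C D)"
  unfolding block_tree_def block_eq_append_rows_hcat[OF assms(5-8)]
  using assms by (intro represents_vstack represents_hstack) (auto simp: hcat_def)

lemma represents_singleton: "\<rho> t = Some c \<Longrightarrow> represents_mat \<rho> (singleton_tree t) (scalar_mat c)"
  by (simp add: represents_mat_iff singleton_tree_def scalar_mat_def)

text \<open>
  Fixed representations of \<open>0\<close> and \<open>1\<close> are constants in the programs.
\<close>

locale unit_codes =
  fixes \<rho> :: "tree \<Rightarrow> 's::{semiring_0,monoid_mult} option" and zero_code one_code :: tree
  assumes zero_code: "\<rho> zero_code = Some 0" and one_code: "\<rho> one_code = Some 1"
begin

text \<open>
  The shape of a zero matrix is given by the lengths of two lists. For square matrices and for column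
  vectors the list of rows has the required length.
\<close>

definition zeros_tree :: "tree \<Rightarrow> tree \<Rightarrow> tree" where
  "zeros_tree s t = list_code (map (\<lambda>_. list_code (map (\<lambda>_. zero_code) (elems t))) (elems s))"

lemma computable_zeros:
  assumes "computable f" "computable g"
  shows "computable (\<lambda>x. zeros_tree (f x) (g x))"
proof -
  have "computable (\<lambda>x. list_code (map ((\<lambda>x _. list_code (map (\<lambda>_. zero_code) (elems (g x)))) x) (elems (f x))))"
    using assms(1)
  proof (rule computable_map[rotated])
    have "computable (\<lambda>t. g (left t))" using computable_comp[OF computable_left[OF computable_id] assms(2)] .
    from computable_map[OF computable_const this]
    show "computable (\<lambda>t. list_code (map (\<lambda>_. zero_code) (elems (g (left t)))))" .
  qed
  then show ?thesis by (simp add: zeros_tree_def)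
qed

definition diag_tree :: "tree \<Rightarrow> tree \<Rightarrow> tree" where
  "diag_tree s t = block_tree s (zeros_tree s t) (zeros_tree t s) t"

lemma computable_diag: "computable f \<Longrightarrow> computable g \<Longrightarrow> computable (\<lambda>x. diag_tree (f x) (g x))"
  unfolding diag_tree_def by (intro computable_block computable_zeros)

definition identity_tree :: "tree \<Rightarrow> tree" where
  "identity_tree t = foldl (\<lambda>s _. diag_tree s (singleton_tree one_code)) Leaf (elems t)"

lemma computable_identity: "computable f \<Longrightarrow> computable (\<lambda>x. identity_tree (f x))"
  unfolding identity_tree_def
  by (rule computable_foldl) (intro computable_diag computable_basic | assumption)+

definition zero_mat_tree :: tree where "zero_mat_tree = singleton_tree zero_code"
definition one_mat_tree :: tree where "one_mat_tree = singleton_tree one_code"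

lemma represents_unit_mats:
  "represents_mat \<rho> zero_mat_tree (0\<^sub>m 1 1)" "represents_mat \<rho> one_mat_tree (1\<^sub>m 1)"
proof -
  have "0\<^sub>m 1 1 = scalar_mat (0::'s)" "1\<^sub>m 1 = scalar_mat (1::'s)"
    by (auto simp: scalar_mat_def)
  then show "represents_mat \<rho> zero_mat_tree (0\<^sub>m 1 1)" "represents_mat \<rho> one_mat_tree (1\<^sub>m 1)"
    using represents_singleton zero_code one_code by (metis zero_mat_tree_def one_mat_tree_def)+
qed

lemma length_unit_mat_trees [simp]: "length (elems zero_mat_tree) = 1" "length (elems one_mat_tree) = 1"
  by (auto simp: zero_mat_tree_def one_mat_tree_def singleton_tree_def)

lemma represents_zeros:
  "length (elems s) = m \<Longrightarrow> length (elems t) = n \<Longrightarrow> represents_mat \<rho> (zeros_tree s t) (0\<^sub>m m n)"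
  by (auto simp: represents_mat_iff zeros_tree_def zero_code)

lemma represents_diag:
  assumes "represents_mat \<rho> s A" "represents_mat \<rho> t D" "A \<in> carrier_mat n n" "D \<in> carrier_mat m m"
  shows "represents_mat \<rho> (diag_tree s t) (block_diag A D)"
  unfolding diag_tree_def block_diag_def
  using assms represents_mat_dim_row[OF assms(1)] represents_mat_dim_row[OF assms(2)]
  by (intro represents_block[of _ _ _ _ _ _ _ _ _ n n m m] represents_zeros) auto

lemma represents_identity: "represents_mat \<rho> (identity_tree t) (1\<^sub>m (length (elems t)))"
proof -
  have "represents_mat \<rho> (foldl (\<lambda>s _. diag_tree s one_mat_tree) Leaf ts) (1\<^sub>m (length ts))" for ts :: "tree list"
  proof (induction ts rule: rev_induct)
    case (snoc t ts)
    have "block_diag (1\<^sub>m (length ts)) (1\<^sub>m 1) = (1\<^sub>m (length (ts @ [t])) :: 's mat)"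
      by (simp add: block_diag_def Suc_eq_plus1)
    then show ?case
      using represents_diag[OF snoc.IH represents_unit_mats(2) one_carrier_mat one_carrier_mat] by simp
  qed (simp add: represents_mat_iff)
  then show ?thesis by (simp add: identity_tree_def one_mat_tree_def)
qed

definition two_copies_tree :: "tree \<Rightarrow> tree" where
  "two_copies_tree a = block_tree (zeros_tree a a) a (zeros_tree a a) a"

lemma represents_two_copies:
  assumes "represents_mat \<rho> a A" "A \<in> carrier_mat n n"
  shows "represents_mat \<rho> (two_copies_tree a) (two_copies A)"
  unfolding two_copies_tree_def two_copies_def
  using assms represents_mat_dim_row[OF assms(1)]
  by (intro represents_block[of _ _ _ _ _ _ _ _ _ n n n n] represents_zeros) auto

definition prefix_code_tree :: "tree \<Rightarrow> tree" where
  "prefix_code_tree as = Node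
     (block_tree (zeros_tree (left as) (left as)) (identity_tree (left as)) (left as) (zeros_tree (left as) (left as)))
     (list_code (map (\<lambda>Z. block_tree Z (zeros_tree (left as) (left as)) (left (right as)) (zeros_tree (left as) (left as)))
       (elems (right (right as)))))"

lemmas computable_matrix_ops = computable_basic computable_zeros computable_block computable_hstack
  computable_vstack computable_diag computable_identity

lemma computable_two_copies_tree: "computable f \<Longrightarrow> computable (\<lambda>x. two_copies_tree (f x))"
  unfolding two_copies_tree_def by (intro computable_block computable_zeros)

lemma computable_prefix_code_tree: "computable f \<Longrightarrow> computable (\<lambda>x. prefix_code_tree (f x))"
proof (erule computable_comp)
  show "computable prefix_code_tree"
    unfolding prefix_code_tree_def[abs_def]
    by (intro computable_map computable_matrix_ops)
qed

lemma represents_prefix_code: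
  assumes rep: "list_all2 (represents_mat \<rho>) (elems t) As"
    and As: "set As \<subseteq> carrier_mat n n" "length As \<ge> 2"
  shows "list_all2 (represents_mat \<rho>) (elems (prefix_code_tree t)) (prefix_code As)"
proof -
  obtain X Y Zs where XYZ: "As = X # Y # Zs" using As(2) by (cases As rule: prefix_code.cases) auto
  with rep obtain x y zs where xyz: "t = Node x (Node y zs)" "represents_mat \<rho> x X" "represents_mat \<rho> y Y"
    "list_all2 (represents_mat \<rho>) (elems zs) Zs"
    by (cases t; cases "right t") auto
  have dims: "X \<in> carrier_mat n n" "Y \<in> carrier_mat n n" "\<And>Z. Z \<in> set Zs \<Longrightarrow> Z \<in> carrier_mat n n"
    using As XYZ by auto
  have zero: "represents_mat \<rho> (zeros_tree x x) (0\<^sub>m n n)" and one: "represents_mat \<rho> (identity_tree x) (1\<^sub>m n)"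
    using represents_zeros represents_identity[of x] represents_mat_dim_row[OF xyz(2)] dims by auto
  have "represents_mat \<rho> (block_tree (zeros_tree x x) (identity_tree x) x (zeros_tree x x)) (code_head X)"
    unfolding code_head_def using dims by (auto intro!: represents_block zero one xyz)
  moreover have "list_all2 (\<lambda>z Z. represents_mat \<rho> (block_tree z (zeros_tree x x) y (zeros_tree x x)) (code_tail Y Z)) (elems zs) Zs"
    using xyz(4)
  proof (rule list.rel_mono_strong)
    fix z Z assume "Z \<in> set Zs" "represents_mat \<rho> z Z"
    moreover from this have "Z \<in> carrier_mat n n" using dims by blast
    ultimately show "represents_mat \<rho> (block_tree z (zeros_tree x x) y (zeros_tree x x)) (code_tail Y Z)"
      using represents_block[OF _ zero xyz(3) zero _ zero_carrier_mat dims(2) zero_carrier_mat, of z Z] dims(2)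
      by (simp add: code_tail_def)
  qed
  ultimately show ?thesis
    by (simp add: XYZ xyz(1) prefix_code_tree_def list.rel_map)
qed

section \<open>Reductions between the reachability problems\<close>

lemma vector_instanceI:
  assumes "1 \<le> n" "length As = r" "set As \<subseteq> carrier_mat n n" "\<alpha> \<in> carrier_mat 1 n" "\<eta> \<in> carrier_mat 1 n"
    "list_all2 (represents_mat \<rho>) (elems as) As" "represents_mat \<rho> a \<alpha>" "represents_mat \<rho> e \<eta>"
    "b \<longleftrightarrow> (\<exists>P \<in> generated (set As). \<alpha> * P = \<eta>)"
  shows "(Node as (Node a (Node e Leaf)), b) \<in> vector_reachability \<rho> r"
proof -
  have "Node as (Node a (Node e Leaf)) = list_code [list_code (elems as), a, e]" by simp
  moreover have "b = vector_reachable n As \<alpha> \<eta>"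
    using reachable_iff_generated(2)[OF assms(3)] assms(9) by blast
  ultimately show ?thesis
    using assms(1-8) unfolding vector_reachability_def by blast
qed

lemma vector_instanceE:
  assumes "(t, b) \<in> vector_reachability \<rho> r"
  obtains n As \<alpha> \<eta> as a e where "t = Node as (Node a (Node e Leaf))"
    "1 \<le> n" "length As = r" "set As \<subseteq> carrier_mat n n" "\<alpha> \<in> carrier_mat 1 n" "\<eta> \<in> carrier_mat 1 n"
    "list_all2 (represents_mat \<rho>) (elems as) As" "represents_mat \<rho> a \<alpha>" "represents_mat \<rho> e \<eta>"
    "b \<longleftrightarrow> (\<exists>P \<in> generated (set As). \<alpha> * P = \<eta>)"
proof -
  from assms obtain n As \<alpha> \<eta> as a e where *: "t = list_code [list_code as, a, e]" "b = vector_reachable n As \<alpha> \<eta>"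
    "1 \<le> n" "length As = r" "set As \<subseteq> carrier_mat n n" "\<alpha> \<in> carrier_mat 1 n" "\<eta> \<in> carrier_mat 1 n"
    "list_all2 (represents_mat \<rho>) as As" "represents_mat \<rho> a \<alpha>" "represents_mat \<rho> e \<eta>"
    unfolding vector_reachability_def by blast
  show thesis
    by (rule that[of "list_code as" a e n As \<alpha> \<eta>]) (use * reachable_iff_generated(2)[OF *(5)] in auto)
qed

lemma matrix_instanceI:
  assumes "1 \<le> n" "length As = r" "set As \<subseteq> carrier_mat n n" "M \<in> carrier_mat n n"
    "list_all2 (represents_mat \<rho>) (elems as) As" "represents_mat \<rho> m M"
    "b \<longleftrightarrow> M \<in> generated (set As)"
  shows "(Node as (Node m Leaf), b) \<in> matrix_reachability \<rho> r"
proof -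
  have "Node as (Node m Leaf) = list_code [list_code (elems as), m]" by simp
  moreover have "b = matrix_reachable n As M"
    using reachable_iff_generated(1)[OF assms(3)] assms(7) by blast
  ultimately show ?thesis
    using assms(1-6) unfolding matrix_reachability_def by blast
qed

lemma matrix_instanceE:
  assumes "(t, b) \<in> matrix_reachability \<rho> r"
  obtains n As M as m where "t = Node as (Node m Leaf)"
    "1 \<le> n" "length As = r" "set As \<subseteq> carrier_mat n n" "M \<in> carrier_mat n n"
    "list_all2 (represents_mat \<rho>) (elems as) As" "represents_mat \<rho> m M"
    "b \<longleftrightarrow> M \<in> generated (set As)"
proof -
  from assms obtain n As M as m where *: "t = list_code [list_code as, m]" "b = matrix_reachable n As M"
    "1 \<le> n" "length As = r" "set As \<subseteq> carrier_mat n n" "M \<in> carrier_mat n n"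
    "list_all2 (represents_mat \<rho>) as As" "represents_mat \<rho> m M"
    unfolding matrix_reachability_def by blast
  show thesis
    by (rule that[of "list_code as" m n As M]) (use * reachable_iff_generated(1)[OF *(5)] in auto)
qed

lemma scalar_instanceI:
  assumes "1 \<le> n" "length As = r" "set As \<subseteq> carrier_mat n n" "\<alpha> \<in> carrier_mat 1 n" "\<beta> \<in> carrier_mat n 1"
    "list_all2 (represents_mat \<rho>) (elems as) As" "represents_mat \<rho> a \<alpha>" "represents_mat \<rho> b \<beta>"
    "\<rho> c = Some \<gamma>" "q \<longleftrightarrow> (\<exists>P \<in> generated (set As). (\<alpha> * P * \<beta>) $$ (0, 0) = \<gamma>)"
  shows "(Node as (Node a (Node b (Node c Leaf))), q) \<in> scalar_reachability \<rho> r"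
proof -
  have "Node as (Node a (Node b (Node c Leaf))) = list_code [list_code (elems as), a, b, c]" by simp
  moreover have "q = scalar_reachable n As \<alpha> \<beta> \<gamma>"
    using reachable_iff_generated(3)[OF assms(3)] assms(10) by blast
  ultimately show ?thesis
    using assms(1-9) unfolding scalar_reachability_def by blast
qed

lemma scalar_instanceE:
  assumes "(t, q) \<in> scalar_reachability \<rho> r"
  obtains n As \<alpha> \<beta> \<gamma> as a b c where "t = Node as (Node a (Node b (Node c Leaf)))"
    "1 \<le> n" "length As = r" "set As \<subseteq> carrier_mat n n" "\<alpha> \<in> carrier_mat 1 n" "\<beta> \<in> carrier_mat n 1"
    "list_all2 (represents_mat \<rho>) (elems as) As" "represents_mat \<rho> a \<alpha>" "represents_mat \<rho> b \<beta>"
    "\<rho> c = Some \<gamma>" "q \<longleftrightarrow> (\<exists>P \<in> generated (set As). (\<alpha> * P * \<beta>) $$ (0, 0) = \<gamma>)"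
proof -
  from assms obtain n As \<alpha> \<beta> \<gamma> as a b c where *: "t = list_code [list_code as, a, b, c]"
    "q = scalar_reachable n As \<alpha> \<beta> \<gamma>"
    "1 \<le> n" "length As = r" "set As \<subseteq> carrier_mat n n" "\<alpha> \<in> carrier_mat 1 n" "\<beta> \<in> carrier_mat n 1"
    "list_all2 (represents_mat \<rho>) as As" "represents_mat \<rho> a \<alpha>" "represents_mat \<rho> b \<beta>" "\<rho> c = Some \<gamma>"
    unfolding scalar_reachability_def by blast
  show thesis
    by (rule that[of "list_code as" a b c n As \<alpha> \<beta> \<gamma>]) (use * reachable_iff_generated(3)[OF *(5)] in auto)
qed

text \<open>
  Reachability depends only on the set of the given matrices.
\<close>

definition repeat_first :: "tree \<Rightarrow> tree" where
  "repeat_first t = Node (Node (left (left t)) (left t)) (right t)"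

lemma computable_repeat_first: "computable repeat_first"
  unfolding repeat_first_def[abs_def] by (intro computable_basic)

lemma repeat_first_letters:
  assumes "list_all2 R (elems as) As" "length As = r" "r \<ge> 1"
  shows "\<exists>B. list_all2 R (elems (Node (left as) as)) (B # As) \<and> length (B # As) = Suc r \<and>
    set (B # As) = set As"
  using assms by (cases as; cases As) auto

lemma vector_more: "r \<ge> 1 \<Longrightarrow> many_one \<rho> (vector_reachability \<rho> r) (vector_reachability \<rho> (Suc r))"
proof (rule many_one_computable[OF computable_repeat_first])
  fix t b assume r: "r \<ge> 1" and "(t, b) \<in> vector_reachability \<rho> r"
  from this(2) show "(repeat_first t, b) \<in> vector_reachability \<rho> (Suc r)"
  proof (cases rule: vector_instanceE)
    case (1 n As \<alpha> \<eta> as a e)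
    from repeat_first_letters[OF 1(7,3) r] obtain B where B:
      "list_all2 (represents_mat \<rho>) (elems (Node (left as) as)) (B # As)" "length (B # As) = Suc r"
      "set (B # As) = set As" by blast
    show ?thesis
      unfolding 1(1) repeat_first_def left.simps right.simps
      by (rule vector_instanceI[where As = "B # As"]) (use 1 B in simp_all)
  qed
qed

lemma scalar_more: "r \<ge> 1 \<Longrightarrow> many_one \<rho> (scalar_reachability \<rho> r) (scalar_reachability \<rho> (Suc r))"
proof (rule many_one_computable[OF computable_repeat_first])
  fix t b assume r: "r \<ge> 1" and "(t, b) \<in> scalar_reachability \<rho> r"
  from this(2) show "(repeat_first t, b) \<in> scalar_reachability \<rho> (Suc r)"
  proof (cases rule: scalar_instanceE)
    case (1 n As \<alpha> \<beta> \<gamma> as a b c)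
    from repeat_first_letters[OF 1(7,3) r] obtain B where B:
      "list_all2 (represents_mat \<rho>) (elems (Node (left as) as)) (B # As)" "length (B # As) = Suc r"
      "set (B # As) = set As" by blast
    show ?thesis
      unfolding 1(1) repeat_first_def left.simps right.simps
      by (rule scalar_instanceI[where As = "B # As"]) (use 1 B in \<open>simp_all del: index_mult_mat\<close>)
  qed
qed

text \<open>
  The input has the form \<open>Node as (Node a (Node e Leaf))\<close>; the rows of the first matrix, counted by
  \<open>left (left t)\<close>, provide the dimension.
\<close>

definition vector_instance_fewer :: "tree \<Rightarrow> tree" where
  "vector_instance_fewer t = Node (prefix_code_tree (left t))
     (Node (hstack (left (right t)) (zeros_tree (left (right t)) (left (left t))))
     (Node (hstack (left (right (right t))) (zeros_tree (left (right t)) (left (left t)))) Leaf))"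

lemma vector_fewer:
  assumes r: "r \<ge> 2"
  shows "many_one \<rho> (vector_reachability \<rho> (Suc r)) (vector_reachability \<rho> r)"
proof (rule many_one_computable)
  show "computable vector_instance_fewer"
    unfolding vector_instance_fewer_def[abs_def]
    by (intro computable_matrix_ops computable_prefix_code_tree)
next
  fix t b assume "(t, b) \<in> vector_reachability \<rho> (Suc r)"
  then show "(vector_instance_fewer t, b) \<in> vector_reachability \<rho> r"
  proof (cases rule: vector_instanceE)
    case (1 n As \<alpha> \<eta> as a e)
    have len: "length As \<ge> 3" "length As \<ge> 2" using 1 r by auto
    obtain X where "X \<in> set As" "represents_mat \<rho> (left as) X"
      using 1(7) len by (cases as; cases As) auto
    then have n: "length (elems (left as)) = n" using 1(4) represents_mat_dim_row by force
    have zero: "represents_mat \<rho> (zeros_tree a (left as)) (0\<^sub>m 1 n)"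
      using represents_zeros[OF _ n, of a 1] represents_mat_dim_row[OF 1(8)] 1(5) by auto
    show ?thesis
      unfolding 1(1) vector_instance_fewer_def left.simps right.simps
    proof (rule vector_instanceI[where As = "prefix_code As" and n = "n + n"])
      show "length (prefix_code As) = r" using length_prefix_code[OF len(2)] 1(3) by simp
      show "set (prefix_code As) \<subseteq> carrier_mat (n + n) (n + n)" using 1(4) len(2) by (rule prefix_code_carrier)
      show "list_all2 (represents_mat \<rho>) (elems (prefix_code_tree as)) (prefix_code As)"
        using 1(7,4) len(2) by (rule represents_prefix_code)
      show "represents_mat \<rho> (hstack a (zeros_tree a (left as))) (hcat \<alpha> (0\<^sub>m 1 n))"
        "represents_mat \<rho> (hstack e (zeros_tree a (left as))) (hcat \<eta> (0\<^sub>m 1 n))"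
        using 1 zero by (auto intro!: represents_hstack)
      show "b = (\<exists>P\<in>generated (set (prefix_code As)). hcat \<alpha> (0\<^sub>m 1 n) * P = hcat \<eta> (0\<^sub>m 1 n))"
        unfolding 1(10) using vector_prefix_code[OF 1(4) len(1) 1(5,6)] by simp
    qed (use 1 in auto)
  qed
qed

definition scalar_instance_fewer :: "tree \<Rightarrow> tree \<Rightarrow> tree" where
  "scalar_instance_fewer c t =
     (let as = list_code (map (\<lambda>A. diag_tree A one_mat_tree) (elems (left t)));
          a = left (right t); b = left (right (right t)); g = left (right (right (right t)))
      in Node (prefix_code_tree as)
        (Node (hstack (hstack a one_mat_tree) (zeros_tree a (left as)))
        (Node (vstack (vstack b zero_mat_tree) (vstack (zeros_tree b zero_mat_tree) (singleton_tree c)))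
        (Node g Leaf))))"

text \<open>
  The only test in all reductions: it compares \<open>\<gamma>\<close> with \<open>0\<close> and takes \<open>c = 1\<close> or \<open>c = 0\<close> accordingly, so
  that \<open>c = \<gamma>\<close> is only possible if \<open>1 = 0\<close>.
\<close>

lemma scalar_fewer:
  assumes r: "r \<ge> 2"
  shows "many_one \<rho> (scalar_reachability \<rho> (Suc r)) (scalar_reachability \<rho> r)"
proof -
  have computable: "computable (scalar_instance_fewer c)" for c
    unfolding scalar_instance_fewer_def[abs_def] Let_def
    by (rule computable_basic computable_prefix_code_tree computable_singleton_tree computable_map
      computable_matrix_ops)+
  have correct: "(scalar_instance_fewer d t, q) \<in> scalar_reachability \<rho> r"
    if t: "(t, q) \<in> scalar_reachability \<rho> (Suc r)"
      and d: "\<rho> d = Some \<delta>" "\<And>\<gamma>. \<rho> (left (right (right (right t)))) = Some \<gamma> \<Longrightarrow> \<delta> = \<gamma> \<Longrightarrow> (1::'s) = 0"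
    for d \<delta> t q
    using t
  proof (cases rule: scalar_instanceE)
    case (1 n As \<alpha> \<beta> \<gamma> as a b c)
    let ?f = "\<lambda>A. block_diag A (1\<^sub>m 1)" and ?fc = "\<lambda>A. diag_tree A one_mat_tree"
    let ?as = "list_code (map ?fc (elems as))"
    have len: "length As \<ge> 3" "length (map ?f As) \<ge> 2" using 1 r by auto
    have fs: "set (map ?f As) \<subseteq> carrier_mat (n + 1) (n + 1)"
      using 1(4) by (auto intro!: block_diag_carrier)
    have rep: "list_all2 (represents_mat \<rho>) (elems ?as) (map ?f As)"
      unfolding elems_list_code list.rel_map using 1(7)
    proof (rule list.rel_mono_strong)
      fix x X assume "X \<in> set As" "represents_mat \<rho> x X"
      then show "represents_mat \<rho> (?fc x) (?f X)"
        using 1(4) by (intro represents_diag[OF _ represents_unit_mats(2)]) auto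
    qed
    then obtain X where "X \<in> set (map ?f As)" "represents_mat \<rho> (left ?as) X"
      using len by (cases as; cases As) auto
    then have n: "length (elems (left ?as)) = n + 1"
      using fs represents_mat_dim_row by (metis carrier_matD(1) subset_iff)
    have dims: "length (elems a) = 1" "length (elems b) = n"
      using represents_mat_dim_row[OF 1(8)] represents_mat_dim_row[OF 1(9)] 1(5,6) by auto
    show ?thesis
      unfolding 1(1) scalar_instance_fewer_def Let_def left.simps right.simps
    proof (rule scalar_instanceI[where As = "prefix_code (map ?f As)" and n = "(n + 1) + (n + 1)"])
      show "length (prefix_code (map ?f As)) = r" using length_prefix_code[OF len(2)] 1(3) by simp
      show "set (prefix_code (map ?f As)) \<subseteq> carrier_mat ((n + 1) + (n + 1)) ((n + 1) + (n + 1))"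
        using fs len(2) by (rule prefix_code_carrier)
      show "list_all2 (represents_mat \<rho>) (elems (prefix_code_tree ?as)) (prefix_code (map ?f As))"
        using rep fs len(2) by (rule represents_prefix_code)
      show "represents_mat \<rho> (hstack (hstack a one_mat_tree) (zeros_tree a (left ?as)))
          (hcat (hcat \<alpha> (1\<^sub>m 1)) (0\<^sub>m 1 (n + 1)))"
        using 1(5,8) represents_zeros[OF dims(1) n] represents_unit_mats
        by (intro represents_hstack) (auto simp: hcat_def)
      show "represents_mat \<rho> (vstack (vstack b zero_mat_tree) (vstack (zeros_tree b zero_mat_tree) (singleton_tree d)))
          ((\<beta> @\<^sub>r 0\<^sub>m 1 1) @\<^sub>r (0\<^sub>m n 1 @\<^sub>r scalar_mat \<delta>))"
        using 1(6,9) represents_zeros[OF dims(2) length_unit_mat_trees(1)] represents_unit_mats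
          represents_singleton[of \<rho>, OF d(1)]
        by (intro represents_vstack) (auto simp: append_rows_def scalar_mat_def)
      show "hcat (hcat \<alpha> (1\<^sub>m 1)) (0\<^sub>m 1 (n + 1)) \<in> carrier_mat 1 ((n + 1) + (n + 1))"
        using 1(5) by (intro hcat_carrier) auto
      show "(\<beta> @\<^sub>r 0\<^sub>m 1 1) @\<^sub>r (0\<^sub>m n 1 @\<^sub>r scalar_mat \<delta>) \<in> carrier_mat ((n + 1) + (n + 1)) 1"
        using 1(6) by (intro carrier_append_rows) auto
      have "\<delta> = \<gamma> \<Longrightarrow> (1::'s) = 0" using d(2)[of \<gamma>] 1(1,10) by simp
      from scalar_prefix_code[OF 1(4) len(1) 1(5,6) this]
      show "q = (\<exists>P\<in>generated (set (prefix_code (map ?f As))).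
          (hcat (hcat \<alpha> (1\<^sub>m 1)) (0\<^sub>m 1 (n + 1)) * P *
            ((\<beta> @\<^sub>r 0\<^sub>m 1 1) @\<^sub>r (0\<^sub>m n 1 @\<^sub>r scalar_mat \<delta>))) $$ (0, 0) = \<gamma>)"
        unfolding 1(11) by simp
    qed (use 1 in auto)
  qed
  from computable[unfolded computable_def] obtain p :: "tree \<Rightarrow> oracle_id prog"
    where p: "\<And>c \<Gamma> t. eval \<Gamma> (p c) t (scalar_instance_fewer c t)" by metis
  have "computable (\<lambda>t. Node (left (right (right (right t)))) zero_code)" by (intro computable_basic)
  then obtain s :: "oracle_id prog"
    where s: "\<And>\<Gamma> t. eval \<Gamma> s t (Node (left (right (right (right t)))) zero_code)"
    unfolding computable_def by metis
  let ?p = "Cond (Seq s (Call Equality_Oracle)) (p one_code) (p zero_code)"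
  have "\<exists>u. eval \<Gamma> ?p t u \<and> (u, q) \<in> scalar_reachability \<rho> r"
    if \<Gamma>: "arithmetic_oracles \<rho> \<Gamma>" and t: "(t, q) \<in> scalar_reachability \<rho> (Suc r)" for \<Gamma> t q
  proof -
    let ?g = "left (right (right (right t)))"
    from t obtain \<gamma> where \<gamma>: "\<rho> ?g = Some \<gamma>" by (cases rule: scalar_instanceE) auto
    have "\<Gamma> Equality_Oracle (Node ?g zero_code) = Some (bool_code (\<gamma> = 0))"
      using \<Gamma> \<gamma> zero_code unfolding arithmetic_oracles_def by blast
    then have test: "eval \<Gamma> (Seq s (Call Equality_Oracle)) t (bool_code (\<gamma> = 0))"
      using s by (blast intro: eval_Seq eval_Call)
    show ?thesis
    proof (cases "\<gamma> = 0")
      case True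
      then have "eval \<Gamma> ?p t (scalar_instance_fewer one_code t)"
        using eval_Cond_true[OF test _ p] by (simp add: bool_code_def)
      then show ?thesis using correct[OF t one_code] \<gamma> True by auto
    next
      case False
      then have "eval \<Gamma> ?p t (scalar_instance_fewer zero_code t)"
        using eval_Cond_false[OF _ p] test by (simp add: bool_code_def)
      then show ?thesis using correct[OF t zero_code] \<gamma> False by auto
    qed
  qed
  then show ?thesis unfolding many_one_def by blast
qed

definition read_off_tree :: "tree \<Rightarrow> tree" where
  "read_off_tree b = block_tree (diag_tree (identity_tree b) (zeros_tree b b)) (vstack (zeros_tree b zero_mat_tree) b)
     (zeros_tree zero_mat_tree (vstack b b)) one_mat_tree"

lemma computable_read_off_tree: "computable f \<Longrightarrow> computable (\<lambda>x. read_off_tree (f x))"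
  unfolding read_off_tree_def
  by (rule computable_block computable_diag computable_identity computable_zeros computable_vstack
      computable_const | assumption)+

lemma represents_read_off:
  assumes "represents_mat \<rho> b \<beta>" "\<beta> \<in> carrier_mat n 1"
  shows "represents_mat \<rho> (read_off_tree b) (read_off \<beta>)"
proof -
  have n: "length (elems b) = n" "dim_row \<beta> = n" using represents_mat_dim_row[OF assms(1)] assms(2) by auto
  have nn: "length (elems (vstack b b)) = n + n" using n by (simp add: vstack_def)
  have "represents_mat \<rho> (diag_tree (identity_tree b) (zeros_tree b b)) (block_diag (1\<^sub>m n) (0\<^sub>m n n))"
    using represents_identity[of b] represents_zeros[OF n(1) n(1)] n
    by (intro represents_diag) auto
  moreover have "represents_mat \<rho> (vstack (zeros_tree b zero_mat_tree) b) (0\<^sub>m n 1 @\<^sub>r \<beta>)"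
    using represents_zeros[OF n(1) length_unit_mat_trees(1)] assms by (intro represents_vstack) auto
  moreover have "represents_mat \<rho> (zeros_tree zero_mat_tree (vstack b b)) (0\<^sub>m 1 (n + n))"
    using represents_zeros[OF length_unit_mat_trees(1) nn] .
  moreover have "block_diag (1\<^sub>m n) (0\<^sub>m n n) \<in> carrier_mat (n + n) (n + n)"
    by (intro block_diag_carrier) auto
  moreover have "0\<^sub>m n 1 @\<^sub>r \<beta> \<in> carrier_mat (n + n) 1" using assms by (intro carrier_append_rows) auto
  ultimately show ?thesis
    unfolding read_off_tree_def read_off_def n
    using represents_unit_mats by (intro represents_block) auto
qed

definition scalar_instance_as_vector :: "tree \<Rightarrow> tree" where
  "scalar_instance_as_vector t =
     (let a = left (right t); b = left (right (right t)); g = left (right (right (right t)))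
      in Node (Node (read_off_tree b) (list_code (map (\<lambda>A. diag_tree (two_copies_tree A) one_mat_tree) (elems (left t)))))
        (Node (hstack (hstack a (zeros_tree a b)) zero_mat_tree)
        (Node (hstack (hstack (zeros_tree a b) (zeros_tree a b)) (singleton_tree g)) Leaf)))"

lemma scalar_to_vector:
  assumes r: "r \<ge> 1"
  shows "many_one \<rho> (scalar_reachability \<rho> r) (vector_reachability \<rho> (Suc r))"
proof (rule many_one_computable)
  show "computable scalar_instance_as_vector"
    unfolding scalar_instance_as_vector_def[abs_def] Let_def
    by (intro computable_matrix_ops computable_read_off_tree computable_singleton_tree computable_map
        computable_two_copies_tree)
next
  fix t q assume "(t, q) \<in> scalar_reachability \<rho> r"
  then show "(scalar_instance_as_vector t, q) \<in> vector_reachability \<rho> (Suc r)"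
  proof (cases rule: scalar_instanceE)
    case (1 n As \<alpha> \<beta> \<gamma> as a b c)
    let ?f = "\<lambda>A. block_diag (two_copies A) (1\<^sub>m 1)" and ?fc = "\<lambda>A. diag_tree (two_copies_tree A) one_mat_tree"
    have As: "As \<noteq> []" using 1 r by auto
    have zero: "represents_mat \<rho> (zeros_tree a b) (0\<^sub>m 1 n)"
      using represents_zeros[of a 1 b n] represents_mat_dim_row[OF 1(8)] represents_mat_dim_row[OF 1(9)] 1(5,6)
      by auto
    have two: "two_copies A \<in> carrier_mat (n + n) (n + n)" if "A \<in> set As" for A
      using that 1(4) by (intro two_copies_carrier) auto
    have rep: "list_all2 (\<lambda>x X. represents_mat \<rho> (?fc x) (?f X)) (elems as) As"
      using 1(7)
    proof (rule list.rel_mono_strong)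
      fix x X assume X: "X \<in> set As" "represents_mat \<rho> x X"
      then have "represents_mat \<rho> (two_copies_tree x) (two_copies X)"
        using 1(4) by (intro represents_two_copies) auto
      then show "represents_mat \<rho> (?fc x) (?f X)"
        using two[OF X(1)] by (intro represents_diag[OF _ represents_unit_mats(2)]) auto
    qed
    have dim: "dim_row \<beta> = n" using 1(6) by auto
    have "read_off \<beta> \<in> carrier_mat (n + n + 1) (n + n + 1)"
      unfolding read_off_def dim
      by (intro four_block_carrier_mat block_diag_carrier) auto
    then have car: "set (read_off \<beta> # map ?f As) \<subseteq> carrier_mat (n + n + 1) (n + n + 1)"
      using two by (auto intro!: block_diag_carrier)
    show ?thesis
      unfolding 1(1) scalar_instance_as_vector_def Let_def left.simps right.simps
    proof (rule vector_instanceI[where As = "read_off \<beta> # map ?f As" and n = "n + n + 1"])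
      show "set (read_off \<beta> # map ?f As) \<subseteq> carrier_mat (n + n + 1) (n + n + 1)" by (rule car)
      show "list_all2 (represents_mat \<rho>) (elems (Node (read_off_tree b) (list_code (map ?fc (elems as)))))
          (read_off \<beta> # map ?f As)"
        using rep represents_read_off[OF 1(9,6)] by (simp add: list.rel_map)
      show "represents_mat \<rho> (hstack (hstack a (zeros_tree a b)) zero_mat_tree)
          (hcat (hcat \<alpha> (0\<^sub>m 1 n)) (0\<^sub>m 1 1))"
        using 1(5,8) zero represents_unit_mats by (intro represents_hstack) (auto simp: hcat_def)
      show "represents_mat \<rho> (hstack (hstack (zeros_tree a b) (zeros_tree a b)) (singleton_tree c))
          (hcat (hcat (0\<^sub>m 1 n) (0\<^sub>m 1 n)) (scalar_mat \<gamma>))"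
        using zero represents_singleton[of \<rho>, OF 1(10)]
        by (intro represents_hstack) (auto simp: hcat_def scalar_mat_def)
      show "hcat (hcat \<alpha> (0\<^sub>m 1 n)) (0\<^sub>m 1 1) \<in> carrier_mat 1 (n + n + 1)"
        "hcat (hcat (0\<^sub>m 1 n) (0\<^sub>m 1 n)) (scalar_mat \<gamma>) \<in> carrier_mat 1 (n + n + 1)"
        using 1(5) by (auto intro!: hcat_carrier)
      show "q = (\<exists>P\<in>generated (set (read_off \<beta> # map ?f As)).
          hcat (hcat \<alpha> (0\<^sub>m 1 n)) (0\<^sub>m 1 1) * P = hcat (hcat (0\<^sub>m 1 n) (0\<^sub>m 1 n)) (scalar_mat \<gamma>))"
        unfolding 1(11) using scalar_as_vector[OF 1(4) As 1(5,6)] by simp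
    qed (use 1 in auto)
  qed
qed

definition diag_copies_tree :: "tree \<Rightarrow> tree \<Rightarrow> tree" where
  "diag_copies_tree m a = foldl (\<lambda>s _. diag_tree s a) Leaf (elems m)"

definition join_rows_tree :: "tree \<Rightarrow> tree" where
  "join_rows_tree m = foldl (\<lambda>s r. hstack s (list_code [r])) (list_code [Leaf]) (elems m)"

lemma computable_join_rows_tree: "computable f \<Longrightarrow> computable (\<lambda>x. join_rows_tree (f x))"
  unfolding join_rows_tree_def list_code.simps
  by (rule computable_foldl) (intro computable_hstack computable_basic | assumption)+

lemma represents_diag_copies:
  assumes a: "represents_mat \<rho> a A" and A: "A \<in> carrier_mat n n"
  shows "represents_mat \<rho> (diag_copies_tree m a) (diag_copies (length (elems m)) A)"
proof -
  have "represents_mat \<rho> (foldl (\<lambda>s _. diag_tree s a) Leaf ts) (diag_copies (length ts) A)" for ts :: "tree list"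
  proof (induction ts rule: rev_induct)
    case (snoc t ts)
    then show ?case using represents_diag[OF snoc.IH a diag_copies_carrier[OF A] A] by simp
  qed (simp add: represents_mat_iff)
  then show ?thesis by (simp add: diag_copies_tree_def)
qed

lemma represents_join_rows:
  assumes m: "represents_mat \<rho> m M" and M: "M \<in> carrier_mat p n"
  shows "represents_mat \<rho> (join_rows_tree m) (join_rows p M)"
proof -
  have len: "length (elems m) = p" using represents_mat_dim_row[OF m] M by auto
  have "represents_mat \<rho> (foldl (\<lambda>s r. hstack s (list_code [r])) (list_code [Leaf]) (take k (elems m))) (join_rows k M)"
    if "k \<le> p" for k
    using that
  proof (induction k)
    case 0
    then show ?case by (simp add: represents_mat_iff)
  next
    case (Suc k)
    have "represents_mat \<rho> (list_code [elems m ! k]) (mat 1 (dim_col M) (\<lambda>(_, j). M $$ (k, j)))"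
      using m M Suc.prems by (simp add: represents_mat_iff)
    then show ?case
      using represents_hstack[OF Suc.IH] Suc.prems join_rows_carrier[OF M, of k] len
      by (simp add: take_Suc_conv_app_nth)
  qed
  from this[of p] show ?thesis by (simp add: join_rows_tree_def len)
qed

definition matrix_instance_as_vector :: "tree \<Rightarrow> tree" where
  "matrix_instance_as_vector t = Node (list_code (map (diag_copies_tree (left (right t))) (elems (left t))))
     (Node (join_rows_tree (identity_tree (left (right t)))) (Node (join_rows_tree (left (right t))) Leaf))"

lemma matrix_to_vector: "many_one \<rho> (matrix_reachability \<rho> r) (vector_reachability \<rho> r)"
proof (rule many_one_computable)
  have "computable (\<lambda>t. diag_copies_tree (left (right (left t))) (right t))"
    unfolding diag_copies_tree_def by (rule computable_foldl) (intro computable_diag computable_basic)+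
  then have "computable (\<lambda>t. list_code (map (diag_copies_tree (left (right t))) (elems (left t))))"
    by (rule computable_map[where h = "\<lambda>t. diag_copies_tree (left (right t))"]) (intro computable_basic)
  then show "computable matrix_instance_as_vector"
    unfolding matrix_instance_as_vector_def[abs_def]
    by (intro computable_join_rows_tree computable_identity computable_basic)
next
  fix t b assume "(t, b) \<in> matrix_reachability \<rho> r"
  then show "(matrix_instance_as_vector t, b) \<in> vector_reachability \<rho> r"
  proof (cases rule: matrix_instanceE)
    case (1 n As M as m)
    have n: "length (elems m) = n" using represents_mat_dim_row[OF 1(7)] 1(5) by auto
    show ?thesis
      unfolding 1(1) matrix_instance_as_vector_def left.simps right.simps
    proof (rule vector_instanceI[where As = "map (diag_copies n) As" and n = "n * n"])
      show "1 \<le> n * n" using mult_le_mono[OF 1(2,2)] by simp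
      show "set (map (diag_copies n) As) \<subseteq> carrier_mat (n * n) (n * n)"
        using 1(4) diag_copies_carrier by auto
      show "list_all2 (represents_mat \<rho>) (elems (list_code (map (diag_copies_tree m) (elems as)))) (map (diag_copies n) As)"
        unfolding elems_list_code list.rel_map using 1(6)
      proof (rule list.rel_mono_strong)
        fix x X assume "X \<in> set As" "represents_mat \<rho> x X"
        then show "represents_mat \<rho> (diag_copies_tree m x) (diag_copies n X)"
          using represents_diag_copies[of x X n m] 1(4) n by auto
      qed
      show "represents_mat \<rho> (join_rows_tree (identity_tree m)) (join_rows n (1\<^sub>m n))"
        using represents_join_rows[OF represents_identity one_carrier_mat] n by metis
      show "represents_mat \<rho> (join_rows_tree m) (join_rows n M)"
        using 1(7,5) by (rule represents_join_rows)
      show "join_rows n (1\<^sub>m n) \<in> carrier_mat 1 (n * n)" "join_rows n M \<in> carrier_mat 1 (n * n)"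
        using 1(5) by (auto intro!: join_rows_carrier)
      show "b = (\<exists>P\<in>generated (set (map (diag_copies n) As)). join_rows n (1\<^sub>m n) * P = join_rows n M)"
        unfolding 1(8) using matrix_as_vector[OF 1(4,5)] by simp
    qed (use 1 in auto)
  qed
qed

text \<open>
  The length of \<open>left v\<close>, the only row of \<open>v\<close>, is the dimension of \<open>v\<close>.
\<close>

definition top_row_tree :: "tree \<Rightarrow> tree" where
  "top_row_tree v = block_tree one_mat_tree v (zeros_tree (left v) one_mat_tree) (zeros_tree (left v) (left v))"

lemma computable_top_row_tree: "computable f \<Longrightarrow> computable (\<lambda>x. top_row_tree (f x))"
  unfolding top_row_tree_def
  by (rule computable_block computable_zeros computable_const computable_left | assumption)+

lemma represents_top_row:
  assumes "represents_mat \<rho> t v" "v \<in> carrier_mat 1 n"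
  shows "represents_mat \<rho> (top_row_tree t) (top_row v)"
proof -
  have "dim_col v = n" and len: "length (elems (left t)) = n"
    using represents_mat_dim_col[OF assms(1)] assms(2) by auto
  then show ?thesis
    unfolding top_row_tree_def top_row_def using assms represents_unit_mats(2)
      represents_zeros[OF len length_unit_mat_trees(2)] represents_zeros[OF len len]
    by (intro represents_block[of _ _ _ _ _ _ _ _ _ 1 1 n n]) auto
qed

definition vector_instance_as_matrix :: "tree \<Rightarrow> tree" where
  "vector_instance_as_matrix t =
     (let a = left (right t); e = left (right (right t)); zs = zeros_tree a (left (left t));
          T = top_row_tree (hstack zs e)
      in Node (prefix_code_tree (Node (top_row_tree (hstack a zs))
          (list_code (map (\<lambda>A. diag_tree one_mat_tree (two_copies_tree A)) (elems (left t))))))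
        (Node (block_tree T (zeros_tree T T) T (zeros_tree T T)) Leaf))"

lemma vector_to_matrix:
  assumes r: "r \<ge> 2"
  shows "many_one \<rho> (vector_reachability \<rho> r) (matrix_reachability \<rho> r)"
proof (rule many_one_computable)
  show "computable vector_instance_as_matrix"
    unfolding vector_instance_as_matrix_def[abs_def] Let_def
    by (intro computable_prefix_code_tree computable_matrix_ops computable_top_row_tree computable_map
        computable_two_copies_tree)
next
  fix t b assume "(t, b) \<in> vector_reachability \<rho> r"
  then show "(vector_instance_as_matrix t, b) \<in> matrix_reachability \<rho> r"
  proof (cases rule: vector_instanceE)
    case (1 n As \<alpha> \<eta> as a e)
    define N where "N = 1 + (n + n)"
    let ?f = "\<lambda>A. block_diag (1\<^sub>m 1) (two_copies A)" and ?fc = "\<lambda>A. diag_tree one_mat_tree (two_copies_tree A)"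
    let ?z = "zeros_tree a (left as)" and ?T = "top_row (hcat (0\<^sub>m 1 n) \<eta>)"
    let ?Xs = "top_row (hcat \<alpha> (0\<^sub>m 1 n)) # map ?f As" and ?t = "top_row_tree (hstack ?z e)"
    have len: "length ?Xs \<ge> 2" using 1 r by auto
    obtain X where "X \<in> set As" "represents_mat \<rho> (left as) X"
      using 1(3,7) r by (cases as; cases As) auto
    then have "length (elems (left as)) = n" using 1(4) represents_mat_dim_row by force
    then have zero: "represents_mat \<rho> ?z (0\<^sub>m 1 n)"
      using represents_zeros[of a 1 "left as" n] represents_mat_dim_row[OF 1(8)] 1(5) by auto
    have s: "represents_mat \<rho> (hstack a ?z) (hcat \<alpha> (0\<^sub>m 1 n))" "hcat \<alpha> (0\<^sub>m 1 n) \<in> carrier_mat 1 (n + n)"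
      and e: "represents_mat \<rho> (hstack ?z e) (hcat (0\<^sub>m 1 n) \<eta>)" "hcat (0\<^sub>m 1 n) \<eta> \<in> carrier_mat 1 (n + n)"
      using 1(5,6,8,9) zero by (auto intro!: represents_hstack)
    have T: "?T \<in> carrier_mat N N" "represents_mat \<rho> ?t ?T"
      using top_row_carrier[OF e(2)] represents_top_row[OF e] by (simp_all add: N_def)
    have zT: "represents_mat \<rho> (zeros_tree ?t ?t) (0\<^sub>m N N)"
      using represents_zeros represents_mat_dim_row[OF T(2)] T(1) by auto
    have two: "two_copies A \<in> carrier_mat (n + n) (n + n)" if "A \<in> set As" for A
      using that 1(4) by (intro two_copies_carrier) auto
    have Xs: "set ?Xs \<subseteq> carrier_mat N N"
      using top_row_carrier[OF s(2)] two by (auto simp: N_def intro!: block_diag_carrier)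
    have "list_all2 (\<lambda>x X. represents_mat \<rho> (?fc x) (?f X)) (elems as) As"
      using 1(7)
    proof (rule list.rel_mono_strong)
      fix x X assume X: "X \<in> set As" "represents_mat \<rho> x X"
      then have "represents_mat \<rho> (two_copies_tree x) (two_copies X)"
        using 1(4) by (intro represents_two_copies) auto
      then show "represents_mat \<rho> (?fc x) (?f X)"
        using two[OF X(1)] by (intro represents_diag[OF represents_unit_mats(2)]) auto
    qed
    then have rep: "list_all2 (represents_mat \<rho>)
        (elems (Node (top_row_tree (hstack a ?z)) (list_code (map ?fc (elems as))))) ?Xs"
      using represents_top_row[OF s] by (simp add: list.rel_map)
    show ?thesis
      unfolding 1(1) vector_instance_as_matrix_def Let_def left.simps right.simps
    proof (rule matrix_instanceI[where As = "prefix_code ?Xs" and n = "N + N"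
          and M = "four_block_mat ?T (0\<^sub>m N N) ?T (0\<^sub>m N N)"])
      show "length (prefix_code ?Xs) = r" using length_prefix_code[OF len] 1(3) by simp
      show "set (prefix_code ?Xs) \<subseteq> carrier_mat (N + N) (N + N)" using Xs len by (rule prefix_code_carrier)
      show "list_all2 (represents_mat \<rho>)
          (elems (prefix_code_tree (Node (top_row_tree (hstack a ?z)) (list_code (map ?fc (elems as))))))
          (prefix_code ?Xs)"
        using rep Xs len by (rule represents_prefix_code)
      show "represents_mat \<rho> (block_tree ?t (zeros_tree ?t ?t) ?t (zeros_tree ?t ?t)) (four_block_mat ?T (0\<^sub>m N N) ?T (0\<^sub>m N N))"
        using T zT by (intro represents_block) auto
      show "four_block_mat ?T (0\<^sub>m N N) ?T (0\<^sub>m N N) \<in> carrier_mat (N + N) (N + N)"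
        using T(1) by auto
      have "length As \<ge> 2" using 1(3) r by simp
      from vector_as_matrix[OF 1(4) this 1(5,6)]
      show "b = (four_block_mat ?T (0\<^sub>m N N) ?T (0\<^sub>m N N) \<in> generated (set (prefix_code ?Xs)))"
        unfolding 1(10) N_def by simp
    qed (auto simp: N_def)
  qed
qed

text \<open>
  The reductions change the number by one, and are iterated down to \<open>2\<close> and up again.
\<close>

lemma many_one_any_number:
  assumes more: "\<And>r. r \<ge> 2 \<Longrightarrow> many_one \<rho> (P r) (P (Suc r))"
    and fewer: "\<And>r. r \<ge> 2 \<Longrightarrow> many_one \<rho> (P (Suc r)) (P r)"
    and "r \<ge> 2" "r' \<ge> 2"
  shows "many_one \<rho> (P r) (P r')"
proof -
  have up: "many_one \<rho> (P 2) (P r)" if "r \<ge> 2" for r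
    using that by (induction rule: dec_induct) (auto intro: many_one_refl many_one_trans more)
  have down: "many_one \<rho> (P r) (P 2)" if "r \<ge> 2" for r
    using that by (induction rule: dec_induct) (auto intro: many_one_refl many_one_trans[OF fewer])
  show ?thesis using many_one_trans[OF down up] assms(3,4) by blast
qed

lemma vector_any_number:
  "r \<ge> 2 \<Longrightarrow> r' \<ge> 2 \<Longrightarrow> many_one \<rho> (vector_reachability \<rho> r) (vector_reachability \<rho> r')"
  by (rule many_one_any_number[where P = "vector_reachability \<rho>"]) (auto intro: vector_more vector_fewer)

lemma scalar_any_number:
  "r \<ge> 2 \<Longrightarrow> r' \<ge> 2 \<Longrightarrow> many_one \<rho> (scalar_reachability \<rho> r) (scalar_reachability \<rho> r')"
  by (rule many_one_any_number[where P = "scalar_reachability \<rho>"]) (auto intro: scalar_more scalar_fewer)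

end

theorem corollary1:
  fixes \<rho> :: "tree \<Rightarrow> 's::{semiring_0,monoid_mult} option"
    and r r' r'' r''' :: nat
  assumes "representation \<rho>"
    and "r \<ge> 2" and "r' \<ge> 2" and "r'' \<ge> 2" and "r''' \<ge> 2"
  shows "equivalent \<rho> (scalar_reachability \<rho> r) (scalar_reachability \<rho> r') \<and>
         reduces \<rho> (scalar_reachability \<rho> r') (vector_reachability \<rho> r'') \<and>
         equivalent \<rho> (vector_reachability \<rho> r'') (matrix_reachability \<rho> r''')"
proof -
  from assms(1) obtain zero_code one_code where "\<rho> zero_code = Some 0" "\<rho> one_code = Some 1"
    unfolding representation_def by blast
  then interpret unit_codes \<rho> zero_code one_code by unfold_locales
  have "many_one \<rho> (scalar_reachability \<rho> r') (vector_reachability \<rho> r'')"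
    using many_one_trans[OF scalar_to_vector vector_any_number] assms by simp
  moreover have "many_one \<rho> (vector_reachability \<rho> r'') (matrix_reachability \<rho> r''')"
    using many_one_trans[OF vector_any_number vector_to_matrix] assms by blast
  moreover have "many_one \<rho> (matrix_reachability \<rho> r''') (vector_reachability \<rho> r'')"
    using many_one_trans[OF matrix_to_vector vector_any_number] assms by blast
  ultimately show ?thesis
    unfolding equivalent_def using scalar_any_number assms many_one_imp_reduces by blast
qed

end
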